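(* Let $a,b\in\mathbb{R}$ with $b>a$, let $f\in AC(a,b)$, and let $0<\alpha<1$. Then, for $t\in(a,b)$, $${}^{CF}\mathbf{D}_{a+}^{\alpha}f(t)=-\frac{M(\alpha)\,f(a^+)}{1-\alpha}\exp\left[-\frac{\alpha\,(t-a)}{1-\alpha}\right]+\frac{M(\alpha)}{1-\alpha}\sum_{k=0}^{\infty}\left(-\frac{\alpha}{1-\alpha}\right)^k J_{a+}^{k}f(t).$$
   Context: $AC(a,b)$ is the class of absolutely continuous functions on $(a,b)$; for such $f$ the derivative $f'$ exists almost everywhere, $f'\in L^1(a,b)$, and $f(a^+)=\lim_{t\to a^+}f(t)$. The Caputo-Fabrizio (CF) operator of order $\alpha\in(0,1)$ is $${}^{CF}\mathbf{D}_{a+}^{\alpha}f(t)=\frac{M(\alpha)}{1-\alpha}\int_a^t\exp\left[-\frac{\alpha}{1-\alpha}(t-\tau)\right]f'(\tau)\,d\tau,$$ where $M(\alpha)$ is a normalization constant depending on $\alpha$ with $M(0)=M(1)=1$. The Riemann-Liouville integral of order $\sigma>0$ is $J_{a+}^{\sigma}f(t)=\frac{1}{\Gamma(\sigma)}\int_a^t f(\tau)(t-\tau)^{\sigma-1}\,d\tau$, and $J_{a+}^{0}f=f$. *)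

theory Defs
  imports "HOL-Analysis.Analysis"
begin

(* The epsilon-delta notion, uniform over the whole of I (not just on its compact
   subintervals). The intervals of a family may touch at endpoints. *)
definition absolutely_continuous_on :: "real set \<Rightarrow> (real \<Rightarrow> real) \<Rightarrow> bool" where
  "absolutely_continuous_on I f \<longleftrightarrow>
     (\<forall>\<epsilon>>0. \<exists>\<delta>>0. \<forall>(n::nat) (x::nat \<Rightarrow> real) (y::nat \<Rightarrow> real).
        (\<forall>i<n. x i \<le> y i \<and> {x i..y i} \<subseteq> I) \<longrightarrow>
        disjoint_family_on (\<lambda>i. {x i<..<y i}) {..<n} \<longrightarrow>
        (\<Sum>i<n. y i - x i) < \<delta> \<longrightarrow>
        (\<Sum>i<n. \<bar>f (y i) - f (x i)\<bar>) < \<epsilon>)"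

(* deriv f has an unspecified value where f is not differentiable; for an absolutely
   continuous f this concerns a null set only and does not affect the integral. *)
definition caputo_fabrizio ::
    "(real \<Rightarrow> real) \<Rightarrow> real \<Rightarrow> real \<Rightarrow> (real \<Rightarrow> real) \<Rightarrow> real \<Rightarrow> real" where
  "caputo_fabrizio M \<alpha> a f t =
     M \<alpha> / (1 - \<alpha>) *
       (LINT \<tau>:{a<..<t}|lebesgue. exp (- (\<alpha> / (1 - \<alpha>)) * (t - \<tau>)) * deriv f \<tau>)"

(* Meant for \<sigma> \<ge> 0. *)
definition riemann_liouville :: "real \<Rightarrow> real \<Rightarrow> (real \<Rightarrow> real) \<Rightarrow> real \<Rightarrow> real" where
  "riemann_liouville \<sigma> a f t =
     (if \<sigma> = 0 then f t
      else 1 / Gamma \<sigma> *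
        (LINT \<tau>:{a<..<t}|lebesgue. f \<tau> * (t - \<tau>) powr (\<sigma> - 1)))"

end

theory Submission
  imports Defs
begin

text \<open>The identity is integration by parts against \<open>exp (- c * (t - x))\<close>, \<open>c = \<alpha> / (1 - \<alpha>)\<close>,
  followed by expanding the exponential into its power series, whose terms integrate to
  Riemann-Liouville integrals. Integration by parts needs the fundamental theorem of calculus for
  absolutely continuous functions, and in particular their differentiability almost everywhere.

  A Lipschitz function is differentiable almost everywhere because its dyadic interpolants
  approximate it in variation: the energies \<open>\<Sum>I. (\<Delta>f I)\<^sup>2 / length I\<close> over the dyadic grids increase
  to a finite limit, and the increase from one grid to another controls the variation of the error.
  A maximal inequality, from Vitali's covering lemma, turns small variation of the error into small
  difference quotients off a small set. The same inequality shows that a function of bounded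
  variation is pointwise Lipschitz almost everywhere, and a squeezing argument in the style of
  Stepanov's theorem reduces that case to Lipschitz functions. Given the derivative almost
  everywhere, the fundamental theorem holds for the gauge integral, since absolute continuity makes
  the tagged intervals over the exceptional null set negligible; local bounded variation upgrades
  it to the Lebesgue integral.\<close>

section \<open>A maximal inequality for functions of bounded variation\<close>

text \<open>\<open>V\<close> is a bound for the variation, not its supremum, so finiteness never has
  to be discussed. Intervals form a set of endpoint pairs, which coverings and divisions supply
  without an ordering.\<close>

definition variation_le :: "real set \<Rightarrow> (real \<Rightarrow> real) \<Rightarrow> real \<Rightarrow> bool" where
  "variation_le I f V \<longleftrightarrow>
     (\<forall>D. finite D \<longrightarrow> (\<forall>(x,y)\<in>D. x \<le> y \<and> {x..y} \<subseteq> I) \<longrightarrow>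
        disjoint_family_on (\<lambda>(x,y). {x<..<y}) D \<longrightarrow>
        (\<Sum>(x,y)\<in>D. \<bar>f y - f x\<bar>) \<le> V)"

lemma variation_leD:
  assumes "variation_le I f V" "finite D" "\<And>x y. (x,y) \<in> D \<Longrightarrow> x \<le> y \<and> {x..y} \<subseteq> I"
    and "disjoint_family_on (\<lambda>(x,y). {x<..<y}) D"
  shows "(\<Sum>(x,y)\<in>D. \<bar>f y - f x\<bar>) \<le> V"
  using assms unfolding variation_le_def by fastforce

text \<open>A weak-type estimate: every exceptional point is an endpoint of an interval whose chord
  is steeper than \<open>l\<close>. Vitali's lemma selects disjoint such intervals whose fivefold
  enlargements cover the set, and their total length is at most \<open>V / l\<close>. The measurable
  cover \<open>T\<close> leaves the measurability of the set itself open.\<close>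

lemma variation_maximal_inequality:
  fixes f :: "real \<Rightarrow> real"
  assumes V: "variation_le {a..b} f V" and l: "0 < l"
  obtains T where "{x \<in> {a..b}. \<exists>y\<in>{a..b}. \<bar>f y - f x\<bar> > l * \<bar>y - x\<bar>} \<subseteq> T"
    "T \<in> lmeasurable" "measure lebesgue T \<le> 5 * V / l"
proof -
  let ?S = "{x \<in> {a..b}. \<exists>y\<in>{a..b}. \<bar>f y - f x\<bar> > l * \<bar>y - x\<bar>}"
  define K where "K = {(u,v). a \<le> u \<and> u < v \<and> v \<le> b \<and> \<bar>f v - f u\<bar> > l * (v - u)}"
  \<comment> \<open>Centre and radius present the intervals as closed balls, the form in which the
    covering lemma takes them.\<close>
  define c where "c = (\<lambda>(u::real,v::real). (u + v) / 2)"
  define r where "r = (\<lambda>(u::real,v::real). (v - u) / 2)"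
  have cb: "cball (c i) (r i) = {fst i..snd i}" for i
    by (cases i) (auto simp: c_def r_def cball_eq_atLeastAtMost field_simps)
  have cov: "?S \<subseteq> (\<Union>i\<in>K. cball (c i) (r i))"
  proof
    fix x assume "x \<in> ?S"
    then obtain y where xy: "x \<in> {a..b}" "y \<in> {a..b}" "\<bar>f y - f x\<bar> > l * \<bar>y - x\<bar>" by auto
    then have "x \<noteq> y" by auto
    then have "(min x y, max x y) \<in> K"
      using xy by (auto simp: K_def min_def max_def abs_minus_commute)
    then show "x \<in> (\<Union>i\<in>K. cball (c i) (r i))"
      unfolding cb by force
  qed
  have rb: "0 < r i \<and> r i \<le> b - a" if "i \<in> K" for i
    using that by (auto simp: K_def r_def field_simps)
  obtain C where C: "countable C" "C \<subseteq> K"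
     "pairwise (\<lambda>i j. disjnt (cball (c i) (r i)) (cball (c j) (r j))) C"
     "?S \<subseteq> (\<Union>i\<in>C. cball (c i) (5 * r i))"
    using Vitali_covering_lemma_cballs[OF cov rb] by blast
  \<comment> \<open>A bound uniform over finite subfamilies passes to the countable union, giving
    both finite measure and the estimate.\<close>
  have fin: "measure lebesgue (\<Union>i\<in>F. cball (c i) (5 * r i)) \<le> 5 * V / l"
    if F: "F \<subseteq> C" "finite F" for F
  proof -
    have "measure lebesgue (\<Union>i\<in>F. cball (c i) (5 * r i))
        \<le> (\<Sum>i\<in>F. measure lebesgue (cball (c i) (5 * r i)))"
      by (rule measure_UNION_le) (use F in auto)
    also have "\<dots> = (\<Sum>i\<in>F. 5 * (snd i - fst i))"
    proof (rule sum.cong)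
      fix i assume "i \<in> F"
      then have "0 < r i" using F C(2) rb by blast
      then show "measure lebesgue (cball (c i) (5 * r i)) = 5 * (snd i - fst i)"
        by (cases i) (simp add: cball_eq_atLeastAtMost r_def field_simps)
    qed simp
    also have "\<dots> \<le> (\<Sum>i\<in>F. 5 / l * \<bar>f (snd i) - f (fst i)\<bar>)"
    proof (rule sum_mono)
      fix i assume "i \<in> F"
      then have "i \<in> K" using F C by auto
      then have "l * (snd i - fst i) \<le> \<bar>f (snd i) - f (fst i)\<bar>"
        by (auto simp: K_def)
      then show "5 * (snd i - fst i) \<le> 5 / l * \<bar>f (snd i) - f (fst i)\<bar>"
        using l by (simp add: field_simps)
    qed
    also have "\<dots> = 5 / l * (\<Sum>(x,y)\<in>F. \<bar>f y - f x\<bar>)"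
      by (simp add: sum_distrib_left case_prod_beta)
    also have "\<dots> \<le> 5 / l * V"
    proof (rule mult_left_mono)
      show "(\<Sum>(x,y)\<in>F. \<bar>f y - f x\<bar>) \<le> V"
      proof (rule variation_leD[OF V \<open>finite F\<close>])
        show "x \<le> y \<and> {x..y} \<subseteq> {a..b}" if "(x,y) \<in> F" for x y
          using that F C(2) by (auto simp: K_def)
        show "disjoint_family_on (\<lambda>(x,y). {x<..<y}) F"
          unfolding disjoint_family_on_def
        proof (intro ballI impI)
          fix i j assume ij: "i \<in> F" "j \<in> F" "i \<noteq> j"
          then have "disjnt (cball (c i) (r i)) (cball (c j) (r j))"
            using C(3) F by (meson pairwiseD subsetD)
          then have "{fst i..snd i} \<inter> {fst j..snd j} = {}"
            unfolding cb by (simp add: disjnt_def)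
          moreover have "{fst i<..<snd i} \<subseteq> {fst i..snd i}" "{fst j<..<snd j} \<subseteq> {fst j..snd j}"
            by auto
          ultimately have "{fst i<..<snd i} \<inter> {fst j<..<snd j} = {}" by blast
          then show "(case i of (x,y) \<Rightarrow> {x<..<y}) \<inter> (case j of (x,y) \<Rightarrow> {x<..<y}) = {}"
            by (simp add: case_prod_beta)
        qed
      qed
    qed (use l in simp)
    finally show ?thesis by simp
  qed
  show thesis
  proof (rule that[OF C(4)])
    show "(\<Union>i\<in>C. cball (c i) (5 * r i)) \<in> lmeasurable"
      by (rule fmeasurable_UN_bound[OF C(1) _ fin]) auto
    show "measure lebesgue (\<Union>i\<in>C. cball (c i) (5 * r i)) \<le> 5 * V / l"
      by (rule measure_UN_bound[OF C(1) _ fin]) auto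
  qed
qed

section \<open>Dyadic approximation of Lipschitz functions\<close>

text \<open>Each square is divided by the cell length \<open>1 / 2^n\<close>, so this is the
  integral over \<open>[0,1]\<close> of the squared slope of the interpolant of level
  \<open>n\<close>.\<close>

definition dyadic_energy :: "(real \<Rightarrow> real) \<Rightarrow> nat \<Rightarrow> real" where
  "dyadic_energy f n = 2^n * (\<Sum>i<2^n. (f (real (Suc i) / 2^n) - f (real i / 2^n))\<^sup>2)"

text \<open>The piecewise affine interpolation of \<open>f\<close> at the points
  \<open>i / 2^n\<close>; the integer floor defines it on the whole line.\<close>

definition dyadic_interpolant :: "(real \<Rightarrow> real) \<Rightarrow> nat \<Rightarrow> real \<Rightarrow> real" where
  "dyadic_interpolant f n x =
     (let i = real_of_int \<lfloor>2^n * x\<rfloor> in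
      f (i / 2^n) + (2^n * x - i) * (f ((i + 1) / 2^n) - f (i / 2^n)))"

text \<open>The floor assigns the right end \<open>u = 1\<close> to the next cell, but adjacent
  affine pieces agree there. Including it lets both ends of a subcell use one formula.\<close>

lemma dyadic_interpolant_cell:
  assumes "0 \<le> u" "u \<le> 1"
  shows "dyadic_interpolant f n ((real i + u) / 2^n)
    = f (real i / 2^n) + u * (f (real (Suc i) / 2^n) - f (real i / 2^n))"
proof (cases "u = 1")
  case True
  have "\<lfloor>2^n * ((real i + u) / 2^n)\<rfloor> = int (Suc i)"
    using True by (simp add: floor_eq_iff)
  then show ?thesis
    by (simp add: dyadic_interpolant_def Let_def True add.commute)
next
  case False
  have "\<lfloor>2^n * ((real i + u) / 2^n)\<rfloor> = int i"
    using assms False by (simp add: floor_eq_iff)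
  then show ?thesis
    by (simp add: dyadic_interpolant_def Let_def add.commute)
qed

text \<open>Cell \<open>k\<close> of the finer grid lies inside the coarse cell
  \<open>k div 2^r\<close>, on which the interpolant is affine, so the coarse increment is shared
  equally among \<open>2^r\<close> subcells.\<close>

lemma dyadic_interpolant_increment:
  "dyadic_interpolant f n (real (Suc k) / 2^(n+r)) - dyadic_interpolant f n (real k / 2^(n+r))
    = (f (real (Suc (k div 2^r)) / 2^n) - f (real (k div 2^r) / 2^n)) / 2^r"
proof -
  define i j where "i = k div 2^r" and "j = k mod 2^r"
  have "k = i * 2^r + j" unfolding i_def j_def by (rule div_mult_mod_eq[symmetric])
  then have k: "real k = real i * 2^r + real j" by simp
  have j: "j < 2^r" unfolding j_def by simp
  then have "real (Suc j) \<le> real (2^r)"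
    by (intro of_nat_mono Suc_leI)
  then have j': "real j \<le> 2^r" "real j + 1 \<le> 2^r" using j by simp_all
  have *: "real (Suc k) / 2^(n+r) = (real i + (real j + 1) / 2^r) / 2^n"
    "real k / 2^(n+r) = (real i + real j / 2^r) / 2^n"
    by (simp_all add: k power_add field_simps)
  have u: "0 \<le> (real j + 1) / 2^r" "(real j + 1) / 2^r \<le> 1" "0 \<le> real j / 2^r" "real j / 2^r \<le> 1"
    using j' by (simp_all add: divide_le_eq_1)
  show ?thesis
    unfolding * i_def[symmetric] dyadic_interpolant_cell[OF u(1,2)] dyadic_interpolant_cell[OF u(3,4)]
    by (simp add: left_diff_distrib[symmetric] diff_divide_distrib[symmetric])
qed

lemma sum_deviation_from_mean:
  fixes d :: "nat \<Rightarrow> real"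
  assumes "0 < R"
  shows "(\<Sum>j<R. (d j - (\<Sum>j<R. d j) / real R)\<^sup>2) = (\<Sum>j<R. (d j)\<^sup>2) - (\<Sum>j<R. d j)\<^sup>2 / real R"
proof -
  define S where "S = (\<Sum>j<R. d j)"
  have "(\<Sum>j<R. (d j - S / R)\<^sup>2) = (\<Sum>j<R. (d j)\<^sup>2 - 2 * S / R * d j + S\<^sup>2 / R\<^sup>2)"
    by (simp add: power2_eq_square field_simps)
  also have "\<dots> = (\<Sum>j<R. (d j)\<^sup>2) - 2 * S / R * S + R * (S\<^sup>2 / R\<^sup>2)"
    unfolding sum.distrib sum_subtractf sum_distrib_left[symmetric] S_def[symmetric] by simp
  also have "\<dots> = (\<Sum>j<R. (d j)\<^sup>2) - S\<^sup>2 / R"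
    using assms by (simp add: power2_eq_square field_simps)
  finally show ?thesis by (simp add: S_def)
qed

text \<open>Pythagoras for interpolation: within a coarse cell the increments of the error are the
  deviations of the fine increments of \<open>f\<close> from their mean, so their squares add up to
  a difference of energies.\<close>

lemma dyadic_energy_increment:
  fixes f :: "real \<Rightarrow> real"
  defines "h \<equiv> (\<lambda>n x. f x - dyadic_interpolant f n x)"
  shows "2^(n+r) * (\<Sum>k<2^(n+r). (h n (real (Suc k) / 2^(n+r)) - h n (real k / 2^(n+r)))\<^sup>2)
    = dyadic_energy f (n+r) - dyadic_energy f n"
proof -
  define R :: nat where "R = 2^r"
  define N :: nat where "N = 2^n"
  have R: "0 < R" "real R = 2^r" and N: "real N = 2^n" by (simp_all add: R_def N_def)
  have NR: "2^(n+r) = N * R" "(2::real)^(n+r) = 2^n * real R" by (simp_all add: R_def N_def power_add)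
  define d where "d = (\<lambda>k. f (real (Suc k) / 2^(n+r)) - f (real k / 2^(n+r)))"
  define D where "D = (\<lambda>i. f (real (Suc i) / 2^n) - f (real i / 2^n))"
  \<comment> \<open>The fine increments within coarse cell \<open>i\<close> telescope, so their mean
    is \<open>D i / R\<close>.\<close>
  have tele: "(\<Sum>j<R. d (i*R + j)) = D i" for i
  proof -
    have "(\<Sum>j<R. d (i*R + j)) = (\<Sum>j<R. f (real (i*R + Suc j) / 2^(n+r)) - f (real (i*R + j) / 2^(n+r)))"
      by (simp add: d_def)
    also have "\<dots> = f (real (i*R + R) / 2^(n+r)) - f (real (i*R + 0) / 2^(n+r))"
      by (rule sum_lessThan_telescope)
    also have "real (i*R + R) / 2^(n+r) = real (Suc i) / 2^n"
      unfolding NR(2) using R(1) by (simp add: field_simps)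
    also have "real (i*R + 0) / 2^(n+r) = real i / 2^n"
      unfolding NR(2) using R(1) by (simp add: field_simps)
    finally show ?thesis by (simp add: D_def)
  qed
  have split: "(\<Sum>k<N*R. g k) = (\<Sum>i<N. \<Sum>j<R. g (i*R + j))" for g :: "nat \<Rightarrow> real"
  proof -
    have "(\<Sum>j<R. g (i*R + j)) = sum g {i*R..<i*R+R}" for i
      using sum.shift_bounds_nat_ivl[of g 0 "i*R" R] by (simp add: lessThan_atLeast0 add.commute)
    then show ?thesis by (simp add: sum.nat_group)
  qed
  have h: "h n (real (Suc k) / 2^(n+r)) - h n (real k / 2^(n+r)) = d k - D (k div R) / R" for k
    using dyadic_interpolant_increment[of f n k r] by (simp add: h_def d_def D_def R_def algebra_simps)
  have "(\<Sum>k<2^(n+r). (h n (real (Suc k) / 2^(n+r)) - h n (real k / 2^(n+r)))\<^sup>2)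
      = (\<Sum>i<N. \<Sum>j<R. (d (i*R + j) - D i / R)\<^sup>2)"
    unfolding h NR(1) split using R by simp
  also have "\<dots> = (\<Sum>i<N. (\<Sum>j<R. (d (i*R + j))\<^sup>2) - (D i)\<^sup>2 / R)"
    using sum_deviation_from_mean[OF R(1), of "\<lambda>j. d (i*R + j)" for i] by (simp add: tele)
  also have "\<dots> = (\<Sum>k<2^(n+r). (d k)\<^sup>2) - (\<Sum>i<2^n. (D i)\<^sup>2) / R"
    unfolding NR(1) split by (simp add: sum_subtractf sum_divide_distrib N_def)
  finally have eq: "(\<Sum>k<2^(n+r). (h n (real (Suc k) / 2^(n+r)) - h n (real k / 2^(n+r)))\<^sup>2)
      = (\<Sum>k<2^(n+r). (d k)\<^sup>2) - (\<Sum>i<2^n. (D i)\<^sup>2) / R" .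
  have E: "dyadic_energy f (n+r) = 2^(n+r) * (\<Sum>k<2^(n+r). (d k)\<^sup>2)"
    "dyadic_energy f n = 2^n * (\<Sum>i<2^n. (D i)\<^sup>2)"
    by (simp_all only: dyadic_energy_def d_def D_def)
  have c: "(2::real)^(n+r) * (A - B / R) = 2^(n+r) * A - 2^n * B" for A B
    unfolding NR(2) using R(1) by (simp add: field_simps)
  show ?thesis
    unfolding eq E by (rule c)
qed

section \<open>Passing from dyadic grids to the whole interval\<close>

lemma dyadic_rounding:
  "(\<lambda>m. real_of_int \<lfloor>2^m * x\<rfloor> / 2^m) \<longlonglongrightarrow> x"
proof (rule tendsto_sandwich)
  show "\<forall>\<^sub>F m in sequentially. x - (1/2)^m \<le> real_of_int \<lfloor>2^m * x\<rfloor> / 2^m"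
  proof (intro always_eventually allI)
    fix m :: nat
    have "(2^m * x - 1) / 2^m \<le> real_of_int \<lfloor>2^m * x\<rfloor> / 2^m"
      by (rule divide_right_mono) (linarith, simp)
    then show "x - (1/2)^m \<le> real_of_int \<lfloor>2^m * x\<rfloor> / 2^m"
      by (simp add: diff_divide_distrib power_one_over)
  qed
  show "\<forall>\<^sub>F m in sequentially. real_of_int \<lfloor>2^m * x\<rfloor> / 2^m \<le> x"
  proof (intro always_eventually allI)
    fix m :: nat
    have "real_of_int \<lfloor>2^m * x\<rfloor> \<le> 2^m * x" by linarith
    then show "real_of_int \<lfloor>2^m * x\<rfloor> / 2^m \<le> x"
      by (simp add: field_simps)
  qed
  have "(\<lambda>m. x - (1/2::real)^m) \<longlonglongrightarrow> x - 0"
    by (intro tendsto_diff tendsto_const LIMSEQ_power_zero) auto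
  then show "(\<lambda>m. x - (1/2)^m) \<longlonglongrightarrow> x" by simp
qed auto

text \<open>The points of the coarser grid also belong to the finer one, so rounding down to the
  finer grid never crosses one of them.\<close>

lemma floor_dyadic_rounding:
  "\<lfloor>2^n * (real_of_int \<lfloor>2^(n+r) * x\<rfloor> / 2^(n+r))\<rfloor> = \<lfloor>2^n * x :: real\<rfloor>"
proof -
  have "\<lfloor>2^n * (real_of_int \<lfloor>2^(n+r) * x\<rfloor> / 2^(n+r))\<rfloor> = \<lfloor>real_of_int \<lfloor>2^(n+r) * x\<rfloor> / of_int (2^r)\<rfloor>"
    by (simp add: power_add)
  also have "\<dots> = \<lfloor>2^(n+r) * x\<rfloor> div 2^r"
    by (rule floor_divide_of_int_eq)
  also have "\<dots> = \<lfloor>2^(n+r) * x / of_int (2^r)\<rfloor>"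
    by (rule floor_divide_real_eq_div[symmetric]) simp
  also have "2^(n+r) * x / of_int (2^r) = 2^n * x"
    by (simp add: power_add)
  finally show ?thesis .
qed

text \<open>From level \<open>n\<close> on, rounding keeps \<open>x\<close> in its cell, where the
  interpolant is a fixed affine function of the rounded point; this takes the place of a continuity
  proof.\<close>

lemma dyadic_interpolant_rounding:
  "(\<lambda>m. dyadic_interpolant f n (real_of_int \<lfloor>2^m * x\<rfloor> / 2^m)) \<longlonglongrightarrow> dyadic_interpolant f n x"
proof -
  define i where "i = real_of_int \<lfloor>2^n * x\<rfloor>"
  have "(\<lambda>m. f (i / 2^n) + (2^n * (real_of_int \<lfloor>2^m * x\<rfloor> / 2^m) - i) * (f ((i + 1) / 2^n) - f (i / 2^n)))
      \<longlonglongrightarrow> f (i / 2^n) + (2^n * x - i) * (f ((i + 1) / 2^n) - f (i / 2^n))"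
    by (intro tendsto_intros dyadic_rounding)
  moreover have "\<forall>\<^sub>F m in sequentially.
      f (i / 2^n) + (2^n * (real_of_int \<lfloor>2^m * x\<rfloor> / 2^m) - i) * (f ((i + 1) / 2^n) - f (i / 2^n))
      = dyadic_interpolant f n (real_of_int \<lfloor>2^m * x\<rfloor> / 2^m)"
    using eventually_ge_at_top[of n]
  proof eventually_elim
    case (elim m)
    then obtain r where "m = n + r" using le_Suc_ex by blast
    then show ?case
      unfolding dyadic_interpolant_def Let_def by (simp only: floor_dyadic_rounding i_def)
  qed
  ultimately show ?thesis
    unfolding dyadic_interpolant_def[of f n x] Let_def i_def[symmetric]
    by (rule Lim_transform_eventually)
qed

text \<open>Rounding the endpoints of a family of intervals down to a fine grid turns its variation
  sum into one over disjoint blocks of grid cells, which the grid sum dominates. Refining the grid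
  recovers the original endpoints in the limit.\<close>

lemma variation_le_dyadicI:
  fixes h :: "real \<Rightarrow> real"
  assumes lim: "\<And>x. (\<lambda>m. h (real_of_int \<lfloor>2^m * x\<rfloor> / 2^m)) \<longlonglongrightarrow> h x"
    and le: "\<And>m. n \<le> m \<Longrightarrow> (\<Sum>k<2^m. \<bar>h (real (Suc k) / 2^m) - h (real k / 2^m)\<bar>) \<le> V"
  shows "variation_le {0..1} h V"
  unfolding variation_le_def
proof (intro allI impI)
  fix D :: "(real \<times> real) set"
  assume fin: "finite D" and sub: "\<forall>(x,y)\<in>D. x \<le> y \<and> {x..y} \<subseteq> {0..1}"
    and disj: "disjoint_family_on (\<lambda>(x,y). {x<..<y}) D"
  let ?r = "\<lambda>m x. real_of_int \<lfloor>2^m * x\<rfloor> / 2^m"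
  have D: "0 \<le> x \<and> x \<le> y \<and> y \<le> 1" if "(x,y) \<in> D" for x y
  proof -
    have "x \<le> y" "{x..y} \<subseteq> {0..1}" using sub that by auto
    then show ?thesis by auto
  qed
  have "(\<lambda>m. \<Sum>(x,y)\<in>D. \<bar>h (?r m y) - h (?r m x)\<bar>) \<longlonglongrightarrow> (\<Sum>(x,y)\<in>D. \<bar>h y - h x\<bar>)"
    unfolding case_prod_beta by (intro tendsto_sum tendsto_rabs tendsto_diff lim)
  moreover have "\<forall>\<^sub>F m in sequentially. (\<Sum>(x,y)\<in>D. \<bar>h (?r m y) - h (?r m x)\<bar>) \<le> V"
    using eventually_ge_at_top[of n]
  proof eventually_elim
    case (elim m)
    define i where "i = (\<lambda>x::real. nat \<lfloor>2^m * x\<rfloor>)"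
    define g where "g = (\<lambda>k. h (real k / 2^m))"
    \<comment> \<open>\<open>A p\<close> collects the grid cells between the rounded endpoints of
      \<open>p\<close>; these blocks are disjoint because the open intervals are.\<close>
    define A where "A = (\<lambda>(x,y). {i x..<i y})"
    have ri: "?r m x = real (i x) / 2^m" if "0 \<le> x" for x
      using that by (simp add: i_def)
    have "(\<Sum>(x,y)\<in>D. \<bar>h (?r m y) - h (?r m x)\<bar>) \<le> (\<Sum>p\<in>D. \<Sum>k\<in>A p. \<bar>g (Suc k) - g k\<bar>)"
    proof (rule sum_mono)
      fix p assume "p \<in> D"
      then obtain x y where p: "p = (x,y)" and xy: "0 \<le> x" "x \<le> y" "y \<le> 1"
        using D by (cases p) auto
      have "i x \<le> i y"
        using xy by (simp add: i_def nat_mono floor_mono)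
      then have "g (i y) - g (i x) = (\<Sum>k\<in>{i x..<i y}. g (Suc k) - g k)"
        by (simp add: sum_Suc_diff')
      then have "\<bar>g (i y) - g (i x)\<bar> \<le> (\<Sum>k\<in>{i x..<i y}. \<bar>g (Suc k) - g k\<bar>)"
        by (simp add: sum_abs)
      then show "(case p of (x,y) \<Rightarrow> \<bar>h (?r m y) - h (?r m x)\<bar>) \<le> (\<Sum>k\<in>A p. \<bar>g (Suc k) - g k\<bar>)"
        using xy by (simp add: p A_def ri g_def)
    qed
    also have "\<dots> = (\<Sum>k\<in>(\<Union>p\<in>D. A p). \<bar>g (Suc k) - g k\<bar>)"
    proof (rule sum.UNION_disjoint[symmetric])
      show "\<forall>p\<in>D. \<forall>q\<in>D. p \<noteq> q \<longrightarrow> A p \<inter> A q = {}"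
      proof (intro ballI impI, rule ccontr)
        fix p q assume pq: "p \<in> D" "q \<in> D" "p \<noteq> q" "A p \<inter> A q \<noteq> {}"
        obtain x y x' y' where e: "p = (x,y)" "q = (x',y')" by (cases p, cases q)
        from pq(4) obtain k where "k \<in> A p" "k \<in> A q" by blast
        then have k: "i x \<le> k" "k < i y" "i x' \<le> k" "k < i y'"
          by (auto simp: A_def e)
        have nn: "0 \<le> x" "0 \<le> y" "0 \<le> x'" "0 \<le> y'" using D pq e by force+
        have a: "z < real (Suc k) / 2^m" if "i z \<le> k" "0 \<le> z" for z
        proof -
          have "\<lfloor>2^m * z\<rfloor> \<le> int k" using that by (simp add: i_def)
          then have "2^m * z < real k + 1" by linarith
          then show ?thesis by (simp add: field_simps)
        qed
        have b: "real (Suc k) / 2^m \<le> z" if "k < i z" "0 \<le> z" for z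
        proof -
          have "int k + 1 \<le> \<lfloor>2^m * z\<rfloor>" using that by (simp add: i_def zless_nat_eq_int_zless)
          then have "real k + 1 \<le> 2^m * z" by linarith
          then show ?thesis by (simp add: field_simps)
        qed
        \<comment> \<open>A shared cell \<open>k\<close> puts the grid point
          \<open>(k + 1) / 2^m\<close> to the right of both left ends and not beyond either right
          end, so the open intervals would meet.\<close>
        have "max x x' < real (Suc k) / 2^m" "real (Suc k) / 2^m \<le> min y y'"
          using a b k nn by auto
        then obtain z where "max x x' < z" "z < min y y'"
          using dense[of "max x x'" "min y y'"] by (metis less_le_trans)
        then have "z \<in> {x<..<y} \<inter> {x'<..<y'}" by auto
        moreover have "{x<..<y} \<inter> {x'<..<y'} = {}"
          using disj pq(1-3) unfolding disjoint_family_on_def e by fastforce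
        ultimately show False by blast
      qed
    qed (auto simp: fin A_def)
    also have "\<dots> \<le> (\<Sum>k<2^m. \<bar>g (Suc k) - g k\<bar>)"
    proof (rule sum_mono2)
      show "(\<Union>p\<in>D. A p) \<subseteq> {..<2^m}"
      proof
        fix k assume "k \<in> (\<Union>p\<in>D. A p)"
        then obtain x y where xy: "(x,y) \<in> D" "k < i y" by (auto simp: A_def)
        have "2^m * y \<le> 2^m" using D[OF xy(1)] by (simp add: mult_left_le)
        then have "\<lfloor>2^m * y\<rfloor> \<le> \<lfloor>(2::real)^m\<rfloor>" by (rule floor_mono)
        then have "i y \<le> 2^m" by (simp add: i_def nat_le_iff)
        then show "k \<in> {..<2^m}" using xy(2) by simp
      qed
    qed auto
    also have "\<dots> \<le> V" using le[OF elim] by (simp add: g_def)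
    finally show ?case .
  qed
  ultimately show "(\<Sum>(x,y)\<in>D. \<bar>h y - h x\<bar>) \<le> V"
    by (rule tendsto_upperbound) simp
qed

text \<open>The energies increase and are bounded by \<open>L\<^sup>2\<close>, so at some level the
  energy is within \<open>e\<^sup>2\<close> of the limit. Later energies exceed it by at most
  \<open>e\<^sup>2\<close>, and Cauchy-Schwarz turns this energy bound for the error into a
  variation bound.\<close>

lemma lipschitz_dyadic_approximation:
  fixes f :: "real \<Rightarrow> real"
  assumes L: "L-lipschitz_on UNIV f" and e: "0 < e"
  obtains n where "variation_le {0..1} (\<lambda>x. f x - dyadic_interpolant f n x) e"
proof -
  define h where "h = (\<lambda>n x. f x - dyadic_interpolant f n x)"
  have mono: "incseq (dyadic_energy f)"
  proof (rule incseq_SucI)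
    fix n
    have "0 \<le> dyadic_energy f (n+1) - dyadic_energy f n"
      unfolding dyadic_energy_increment[symmetric] by (intro mult_nonneg_nonneg sum_nonneg) auto
    then show "dyadic_energy f n \<le> dyadic_energy f (Suc n)" by simp
  qed
  have bd: "dyadic_energy f n \<le> L\<^sup>2" for n
  proof -
    have "(\<Sum>i<2^n. (f (real (Suc i) / 2^n) - f (real i / 2^n))\<^sup>2) \<le> (\<Sum>i<(2::nat)^n. (L / 2^n)\<^sup>2)"
    proof (rule sum_mono)
      fix i
      have "\<bar>f (real (Suc i) / 2^n) - f (real i / 2^n)\<bar> \<le> L * \<bar>real (Suc i) / 2^n - real i / 2^n\<bar>"
        using lipschitz_onD[OF L] by (simp add: dist_real_def)
      also have "\<dots> = L / 2^n" by (simp add: diff_divide_distrib[symmetric])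
      finally show "(f (real (Suc i) / 2^n) - f (real i / 2^n))\<^sup>2 \<le> (L / 2^n)\<^sup>2"
        by (rule abs_le_square_iff[THEN iffD1, OF order_trans]) (simp add: lipschitz_on_nonneg[OF L])
    qed
    also have "\<dots> = L\<^sup>2 / 2^n" by (simp add: power2_eq_square)
    finally show ?thesis unfolding dyadic_energy_def by (simp add: field_simps)
  qed
  obtain l where l: "dyadic_energy f \<longlonglongrightarrow> l" "\<And>n. dyadic_energy f n \<le> l"
    using incseq_convergent[OF mono] bd by blast
  have "\<forall>\<^sub>F n in sequentially. l - e\<^sup>2 < dyadic_energy f n"
    by (rule order_tendstoD(1)[OF l(1)]) (use e in simp)
  then obtain n where n: "l - e\<^sup>2 < dyadic_energy f n"
    by (metis eventually_happens trivial_limit_sequentially)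
  have "variation_le {0..1} (h n) e"
  proof (rule variation_le_dyadicI[where n = n])
    have "isCont f x" for x
      using lipschitz_on_continuous_within[OF L, of x] by simp
    then have "(\<lambda>m. f (real_of_int \<lfloor>2^m * x\<rfloor> / 2^m)) \<longlonglongrightarrow> f x" for x
      using isCont_tendsto_compose dyadic_rounding by blast
    then show "(\<lambda>m. h n (real_of_int \<lfloor>2^m * x\<rfloor> / 2^m)) \<longlonglongrightarrow> h n x" for x
      unfolding h_def by (intro tendsto_diff dyadic_interpolant_rounding)
    fix m assume "n \<le> m"
    then obtain r where m: "m = n + r" using le_Suc_ex by blast
    let ?x = "\<lambda>k. \<bar>h n (real (Suc k) / 2^m) - h n (real k / 2^m)\<bar>"
    \<comment> \<open>Cauchy-Schwarz; the number \<open>2^m\<close> of cells is exactly the weight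
      in the energy identity.\<close>
    have "(\<Sum>k<2^m. ?x k)\<^sup>2 \<le> (\<Sum>k<2^m. (?x k)\<^sup>2) * card {..<(2::nat)^m}"
      by (rule sum_squared_le_sum_of_squares)
    also have "\<dots> = dyadic_energy f m - dyadic_energy f n"
      unfolding m h_def dyadic_energy_increment[symmetric] by (simp add: mult.commute)
    also have "\<dots> \<le> e\<^sup>2" using n l(2)[of m] by linarith
    finally show "(\<Sum>k<2^m. ?x k) \<le> e"
      by (rule power2_le_imp_le) (use e in simp)
  qed
  then have "variation_le {0..1} (\<lambda>x. f x - dyadic_interpolant f n x) e" by (simp only: h_def)
  then show thesis by (rule that)
qed

section \<open>Differentiability almost everywhere\<close>

lemma has_real_derivative_approx:
  assumes "(f has_real_derivative D) (at x)" "0 < e"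
  shows "\<forall>\<^sub>F y in at x. \<bar>f y - f x - D * (y - x)\<bar> \<le> e * \<bar>y - x\<bar>"
proof -
  have "((\<lambda>y. (f y - f x) / (y - x)) \<longlongrightarrow> D) (at x)"
    using assms(1) by (simp add: has_field_derivative_iff)
  then have "\<forall>\<^sub>F y in at x. dist ((f y - f x) / (y - x)) D < e"
    using assms(2) by (rule tendstoD)
  moreover have "\<forall>\<^sub>F y in at x. y \<noteq> x"
    by (simp add: eventually_neq_at_within)
  ultimately show ?thesis
  proof eventually_elim
    case (elim y)
    have "\<bar>f y - f x - D * (y - x)\<bar> = \<bar>(f y - f x) / (y - x) - D\<bar> * \<bar>y - x\<bar>"
      using elim(2) by (simp add: abs_mult[symmetric] field_simps)
    also have "\<dots> \<le> e * \<bar>y - x\<bar>"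
      using elim(1) by (intro mult_right_mono) (auto simp: dist_real_def)
    finally show ?case .
  qed
qed

text \<open>The approximating slope may depend on \<open>e\<close>. Two slopes that serve the same
  nearby \<open>y\<close> differ by at most the sum of their tolerances, so the slopes for
  \<open>1 / (n + 1)\<close> form a Cauchy sequence, whose limit is the derivative.\<close>

lemma differentiable_if_nearly_linear:
  fixes f :: "real \<Rightarrow> real"
  assumes "\<And>e. 0 < e \<Longrightarrow> \<exists>D. \<forall>\<^sub>F y in at x. \<bar>f y - f x - D * (y - x)\<bar> \<le> e * \<bar>y - x\<bar>"
  shows "f differentiable at x"
proof -
  have "\<exists>D. \<forall>n. \<forall>\<^sub>F y in at x. \<bar>f y - f x - D n * (y - x)\<bar> \<le> inverse (real (Suc n)) * \<bar>y - x\<bar>"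
    using assms by (intro choice allI) simp
  then obtain D where D: "\<And>n. \<forall>\<^sub>F y in at x. \<bar>f y - f x - D n * (y - x)\<bar> \<le> inverse (real (Suc n)) * \<bar>y - x\<bar>"
    by blast
  have DD: "\<bar>D m - D n\<bar> \<le> inverse (real (Suc m)) + inverse (real (Suc n))" for m n
  proof -
    have "\<forall>\<^sub>F y in at x. y \<noteq> x"
      by (simp add: eventually_neq_at_within)
    with D[of m] D[of n] have "\<forall>\<^sub>F y in at x. \<bar>D m - D n\<bar> \<le> inverse (real (Suc m)) + inverse (real (Suc n))"
    proof eventually_elim
      case (elim y)
      have "\<bar>D m - D n\<bar> * \<bar>y - x\<bar> = \<bar>D m * (y - x) - D n * (y - x)\<bar>"
        by (simp add: abs_mult[symmetric] left_diff_distrib)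
      also have "\<dots> \<le> inverse (real (Suc m)) * \<bar>y - x\<bar> + inverse (real (Suc n)) * \<bar>y - x\<bar>"
        using elim(1,2) by linarith
      also have "\<dots> = (inverse (real (Suc m)) + inverse (real (Suc n))) * \<bar>y - x\<bar>"
        by (simp add: distrib_right)
      finally show ?case using elim(3) by (simp add: mult_le_cancel_right)
    qed
    then show ?thesis by simp
  qed
  have small: "\<exists>N. \<forall>n\<ge>N. inverse (real (Suc n)) < e" if "0 < e" for e
  proof -
    have "\<forall>\<^sub>F n in sequentially. inverse (real (Suc n)) < e"
      using order_tendstoD(2)[OF LIMSEQ_inverse_real_of_nat that] .
    then show ?thesis by (simp add: eventually_sequentially)
  qed
  have "Cauchy D"
  proof (rule metric_CauchyI)
    fix e :: real assume "0 < e"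
    then obtain N where "\<And>n. n \<ge> N \<Longrightarrow> inverse (real (Suc n)) < e / 2" using small[of "e/2"] by auto
    then have "dist (D m) (D n) < e" if "m \<ge> N" "n \<ge> N" for m n
      using DD[of m n] that unfolding dist_real_def by (smt (verit) field_sum_of_halves)
    then show "\<exists>N. \<forall>m\<ge>N. \<forall>n\<ge>N. dist (D m) (D n) < e" by blast
  qed
  then obtain l where l: "D \<longlonglongrightarrow> l" using Cauchy_convergent_iff convergent_def by blast
  have "((\<lambda>y. (f y - f x) / (y - x)) \<longlongrightarrow> l) (at x)"
  proof (rule tendstoI)
    fix e :: real assume "0 < e"
    then obtain N where N: "\<And>n. n \<ge> N \<Longrightarrow> inverse (real (Suc n)) < e / 2" using small[of "e/2"] by auto
    obtain M where M: "\<And>n. n \<ge> M \<Longrightarrow> dist (D n) l < e / 2"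
      using metric_LIMSEQ_D[OF l, of "e/2"] \<open>0 < e\<close> by auto
    define n where "n = max M N"
    have n: "inverse (real (Suc n)) < e / 2" "\<bar>D n - l\<bar> < e / 2"
      using N[of n] M[of n] by (simp_all add: n_def dist_real_def)
    have "\<forall>\<^sub>F y in at x. y \<noteq> x"
      by (simp add: eventually_neq_at_within)
    with D[of n] show "\<forall>\<^sub>F y in at x. dist ((f y - f x) / (y - x)) l < e"
    proof eventually_elim
      case (elim y)
      have "\<bar>(f y - f x) / (y - x) - D n\<bar> = \<bar>f y - f x - D n * (y - x)\<bar> / \<bar>y - x\<bar>"
        using elim(2) by (simp add: abs_divide[symmetric] diff_divide_distrib)
      also have "\<dots> \<le> inverse (real (Suc n))"
        using elim by (simp only: divide_le_eq) auto
      finally show ?case using n unfolding dist_real_def by linarith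
    qed
  qed
  then have "(f has_real_derivative l) (at x)" by (simp add: has_field_derivative_iff)
  then show ?thesis by (auto simp: real_differentiable_def)
qed

lemma dyadic_interpolant_locally_linear:
  assumes "\<And>i::int. x \<noteq> of_int i / 2^n"
  shows "\<exists>D. \<forall>\<^sub>F y in at x. dyadic_interpolant f n y - dyadic_interpolant f n x = D * (y - x)"
proof -
  define i where "i = \<lfloor>2^n * x\<rfloor>"
  have "of_int i \<noteq> 2^n * x" using assms[of i] by (simp add: field_simps)
  then have "of_int i < 2^n * x"
    using of_int_floor_le[of "2^n * x"] unfolding i_def by linarith
  moreover have "2^n * x < of_int i + 1" unfolding i_def by linarith
  ultimately have x: "of_int i / 2^n < x" "x < (of_int i + 1) / 2^n"
    by (simp_all add: field_simps)
  have "\<forall>\<^sub>F y in at x. of_int i / 2^n < y \<and> y < (of_int i + 1) / 2^n"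
    using x by (intro eventually_conj order_tendstoD[OF tendsto_ident_at]) auto
  then have "\<forall>\<^sub>F y in at x. dyadic_interpolant f n y - dyadic_interpolant f n x
      = 2^n * (f ((of_int i + 1) / 2^n) - f (of_int i / 2^n)) * (y - x)"
  proof eventually_elim
    case (elim y)
    then have "\<lfloor>2^n * y\<rfloor> = i" by (simp add: floor_eq_iff field_simps)
    moreover have "\<lfloor>2^n * x\<rfloor> = i" by (simp only: i_def)
    ultimately show ?case
      by (simp only: dyadic_interpolant_def Let_def) (simp add: algebra_simps)
  qed
  then show ?thesis by blast
qed

section \<open>Lipschitz functions: Rademacher's theorem on the line\<close>

text \<open>Subtract an interpolant whose error \<open>h\<close> has tiny variation. Off a small set
  the difference quotients of \<open>h\<close> are at most \<open>e\<close>, and off the grid the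
  interpolant is locally linear, so \<open>f\<close> is linear up to \<open>e\<close> there. Since
  the small set can be made arbitrarily small, each \<open>bad e\<close> is null.\<close>

lemma lipschitz_negligible_nondifferentiable_unit:
  fixes f :: "real \<Rightarrow> real"
  assumes L: "L-lipschitz_on UNIV f"
  shows "negligible {x\<in>{0..1}. \<not> f differentiable at x}"
proof -
  define Q :: "real set" where "Q = (\<Union>n. range (\<lambda>i::int. of_int i / 2^n))"
  define bad where "bad = (\<lambda>e. {x\<in>{0..1} - Q. \<not> (\<exists>D. \<forall>\<^sub>F y in at x. \<bar>f y - f x - D * (y - x)\<bar> \<le> e * \<bar>y - x\<bar>)})"
  have "countable Q" by (simp add: Q_def)
  then have Q: "negligible Q" by (simp add: negligible_iff_null_sets null_sets_completionI countable_imp_null_set_lborel)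
  \<comment> \<open>The endpoints are dyadic, so every point of \<open>bad e\<close> is interior and
    nearby \<open>y\<close> stay in the unit interval.\<close>
  have 01: "0 \<in> Q" "1 \<in> Q"
    unfolding Q_def by (auto intro!: exI[of _ 0] image_eqI[of _ _ 0] image_eqI[of _ _ 1])
  have bad: "negligible (bad e)" if e: "0 < e" for e
    unfolding negligible_outer_le
  proof (intro allI impI)
    fix k :: real assume k: "0 < k"
    \<comment> \<open>The tolerance \<open>k * e / 5\<close> is what the maximal inequality at level
      \<open>e\<close> converts into measure \<open>k\<close>.\<close>
    obtain n where n: "variation_le {0..1} (\<lambda>x. f x - dyadic_interpolant f n x) (k * e / 5)"
      using lipschitz_dyadic_approximation[OF L, of "k * e / 5"] e k by auto
    define h where "h = (\<lambda>x. f x - dyadic_interpolant f n x)"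
    obtain T where T: "{x \<in> {0..1}. \<exists>y\<in>{0..1}. \<bar>h y - h x\<bar> > e * \<bar>y - x\<bar>} \<subseteq> T"
      "T \<in> lmeasurable" "measure lebesgue T \<le> 5 * (k * e / 5) / e"
      using variation_maximal_inequality[OF n e] unfolding h_def by blast
    have "bad e \<subseteq> T"
    proof
      fix x assume x: "x \<in> bad e"
      then have x01: "x \<in> {0<..<1}" using 01 by (auto simp: bad_def less_le)
      have "\<exists>y\<in>{0..1}. \<bar>h y - h x\<bar> > e * \<bar>y - x\<bar>"
      proof (rule ccontr)
        assume "\<not> ?thesis"
        then have h: "\<bar>h y - h x\<bar> \<le> e * \<bar>y - x\<bar>" if "y \<in> {0..1}" for y using that by force
        have "\<And>i::int. x \<noteq> of_int i / 2^n" using x by (auto simp: bad_def Q_def)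
        then obtain D where D: "\<forall>\<^sub>F y in at x. dyadic_interpolant f n y - dyadic_interpolant f n x = D * (y - x)"
          using dyadic_interpolant_locally_linear by blast
        have "\<forall>\<^sub>F y in at x. 0 < y \<and> y < 1"
          using x01 by (intro eventually_conj order_tendstoD[OF tendsto_ident_at]) auto
        with D have "\<forall>\<^sub>F y in at x. \<bar>f y - f x - D * (y - x)\<bar> \<le> e * \<bar>y - x\<bar>"
        proof eventually_elim
          case (elim y)
          then show ?case using h[of y] by (simp add: h_def algebra_simps)
        qed
        then show False using x by (auto simp: bad_def)
      qed
      then show "x \<in> T" using T(1) x01 by auto
    qed
    then show "\<exists>T. bad e \<subseteq> T \<and> T \<in> lmeasurable \<and> measure lebesgue T \<le> k"
      using T e by auto
  qed
  have "{x\<in>{0..1}. \<not> f differentiable at x} \<subseteq> Q \<union> (\<Union>n. bad (inverse (real (Suc n))))"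
  proof
    fix x assume x: "x \<in> {x\<in>{0..1}. \<not> f differentiable at x}"
    show "x \<in> Q \<union> (\<Union>n. bad (inverse (real (Suc n))))"
    proof (rule ccontr)
      assume nx: "x \<notin> Q \<union> (\<Union>n. bad (inverse (real (Suc n))))"
      have "f differentiable at x"
      proof (rule differentiable_if_nearly_linear)
        fix e :: real assume "0 < e"
        then obtain n where n: "inverse (real (Suc n)) < e" using reals_Archimedean by blast
        obtain D where "\<forall>\<^sub>F y in at x. \<bar>f y - f x - D * (y - x)\<bar> \<le> inverse (real (Suc n)) * \<bar>y - x\<bar>"
          using nx x by (auto simp: bad_def)
        then have "\<forall>\<^sub>F y in at x. \<bar>f y - f x - D * (y - x)\<bar> \<le> e * \<bar>y - x\<bar>"
          by eventually_elim (use n in \<open>meson abs_ge_zero less_imp_le mult_right_mono order_trans\<close>)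
        then show "\<exists>D. \<forall>\<^sub>F y in at x. \<bar>f y - f x - D * (y - x)\<bar> \<le> e * \<bar>y - x\<bar>" by blast
      qed
      then show False using x by simp
    qed
  qed
  moreover have "negligible (Q \<union> (\<Union>n. bad (inverse (real (Suc n)))))"
    by (intro negligible_Un Q negligible_countable_Union) (auto intro!: bad)
  ultimately show ?thesis by (rule negligible_subset[rotated])
qed

lemma lipschitz_negligible_nondifferentiable:
  fixes f :: "real \<Rightarrow> real"
  assumes L: "L-lipschitz_on UNIV f"
  shows "negligible {x. \<not> f differentiable at x}"
proof -
  define S where "S = (\<lambda>k::int. (+) (of_int k) ` {x\<in>{0..1}. \<not> (\<lambda>y. f (of_int k + y)) differentiable at x})"
  have "negligible (S k)" for k
    unfolding S_def
  proof (intro negligible_translation lipschitz_negligible_nondifferentiable_unit)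
    show "L-lipschitz_on UNIV (\<lambda>y. f (of_int k + y))"
      using L unfolding lipschitz_on_def by (simp add: dist_real_def) (metis add_diff_cancel_left)
  qed
  then have "negligible (\<Union>k. S k)"
    by (intro negligible_countable_Union) auto
  moreover have "{x. \<not> f differentiable at x} \<subseteq> (\<Union>k. S k)"
  proof
    fix x assume x: "x \<in> {x. \<not> f differentiable at x}"
    define k where "k = \<lfloor>x\<rfloor>"
    have "\<not> (\<lambda>y. f (of_int k + y)) differentiable at (x - of_int k)"
    proof
      assume "(\<lambda>y. f (of_int k + y)) differentiable at (x - of_int k)"
      then obtain D where "((\<lambda>y. f (of_int k + y)) has_real_derivative D) (at (x - of_int k))"
        using real_differentiable_def by blast
      then have "(f has_real_derivative D) (at x)"
        by (simp add: DERIV_at_within_shift[of f D "of_int k" "x - of_int k" UNIV, simplified])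
      then show False using x by (auto simp: real_differentiable_def)
    qed
    moreover have "x - of_int k \<in> {0..1}" unfolding k_def by (simp; linarith)
    ultimately have "of_int k + (x - of_int k) \<in> S k"
      unfolding S_def by blast
    then show "x \<in> (\<Union>k. S k)" by auto
  qed
  ultimately show ?thesis by (rule negligible_subset)
qed

section \<open>Stepanov-type reduction of bounded variation to the Lipschitz case\<close>

text \<open>McShane's extension of \<open>f\<close> from \<open>E\<close>, an infimum of cones.
  Because the estimate links points of \<open>E\<close> with all points of \<open>I\<close>, the
  extension also majorizes \<open>f\<close> throughout \<open>I\<close>.\<close>

lemma lipschitz_upper_envelope:
  fixes f :: "real \<Rightarrow> real"
  assumes L: "0 \<le> L" and E: "E \<noteq> {}"
    and f: "\<And>x y. x \<in> E \<Longrightarrow> y \<in> I \<Longrightarrow> \<bar>f y - f x\<bar> \<le> L * \<bar>y - x\<bar>" and EI: "E \<subseteq> I"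
  obtains v where "L-lipschitz_on UNIV v" "\<And>x. x \<in> I \<Longrightarrow> f x \<le> v x" "\<And>x. x \<in> E \<Longrightarrow> v x = f x"
proof -
  define v where "v = (\<lambda>x. INF z\<in>E. f z + L * \<bar>x - z\<bar>)"
  have tri: "L * \<bar>x - z\<bar> \<le> L * \<bar>x - y\<bar> + L * \<bar>y - z\<bar>" for x y z
    using mult_left_mono[OF abs_triangle_ineq[of "x - y" "y - z"] L] by (simp add: distrib_left)
  have bdd: "bdd_below ((\<lambda>z. f z + L * \<bar>x - z\<bar>) ` E)" for x
  proof -
    obtain z0 where z0: "z0 \<in> E" using E by blast
    have "f z0 - L * \<bar>x - z0\<bar> \<le> f z + L * \<bar>x - z\<bar>" if "z \<in> E" for z
      using f[OF that, of z0] EI z0 tri[of z0 z x] by (auto simp: abs_minus_commute)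
    then show ?thesis by (auto intro!: bdd_belowI)
  qed
  have vle: "v x \<le> v y + L * \<bar>x - y\<bar>" for x y
  proof -
    have "v x - L * \<bar>x - y\<bar> \<le> v y"
      unfolding v_def
    proof (rule cINF_greatest[OF E])
      fix z assume "z \<in> E"
      then have "v x \<le> f z + L * \<bar>x - z\<bar>" unfolding v_def by (intro cINF_lower bdd)
      then show "(INF z\<in>E. f z + L * \<bar>x - z\<bar>) - L * \<bar>x - y\<bar> \<le> f z + L * \<bar>y - z\<bar>"
        using tri[of x z y] unfolding v_def by linarith
    qed
    then show ?thesis by simp
  qed
  show thesis
  proof (rule that[of v])
    show "L-lipschitz_on UNIV v"
    proof (rule lipschitz_onI)
      fix x y show "dist (v x) (v y) \<le> L * dist x y"
        using vle[of x y] vle[of y x] by (simp add: dist_real_def abs_minus_commute abs_le_iff)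
    qed (rule L)
    show fv: "f x \<le> v x" if "x \<in> I" for x
      unfolding v_def
    proof (rule cINF_greatest[OF E])
      fix z assume "z \<in> E"
      then show "f x \<le> f z + L * \<bar>x - z\<bar>" using f[of z x] that by linarith
    qed
    show "v x = f x" if "x \<in> E" for x
    proof (rule antisym)
      have "v x \<le> f x + L * \<bar>x - x\<bar>" unfolding v_def by (intro cINF_lower bdd that)
      then show "v x \<le> f x" by simp
    qed (use fv that EI in auto)
  qed
qed

text \<open>Following Maly's proof of Stepanov's theorem: on \<open>E\<close> the function is squeezed between
  two Lipschitz envelopes that touch it, so it inherits their derivatives.\<close>
lemma pointwise_lipschitz_negligible_nondifferentiable:
  fixes f :: "real \<Rightarrow> real"
  assumes L: "0 \<le> L" and I: "open I" and EI: "E \<subseteq> I"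
    and f: "\<And>x y. x \<in> E \<Longrightarrow> y \<in> I \<Longrightarrow> \<bar>f y - f x\<bar> \<le> L * \<bar>y - x\<bar>"
  shows "negligible {x\<in>E. \<not> f differentiable at x}"
proof (cases "E = {}")
  case False
  obtain v where v: "L-lipschitz_on UNIV v" "\<And>x. x \<in> I \<Longrightarrow> f x \<le> v x" "\<And>x. x \<in> E \<Longrightarrow> v x = f x"
    using lipschitz_upper_envelope[OF L False f EI] by blast
  have f': "\<bar>- f y - - f x\<bar> \<le> L * \<bar>y - x\<bar>" if "x \<in> E" "y \<in> I" for x y
    using f[OF that] by linarith
  \<comment> \<open>An upper envelope of \<open>- f\<close>: then \<open>- w\<close> is a Lipschitz
    minorant of \<open>f\<close> on \<open>I\<close> touching it on \<open>E\<close>.\<close>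
  obtain w where w: "L-lipschitz_on UNIV w" "\<And>x. x \<in> I \<Longrightarrow> - f x \<le> w x" "\<And>x. x \<in> E \<Longrightarrow> w x = - f x"
    using lipschitz_upper_envelope[of L E I "\<lambda>x. - f x", OF L False f' EI] by blast
  have "{x\<in>E. \<not> f differentiable at x} \<subseteq> {x. \<not> v differentiable at x} \<union> {x. \<not> w differentiable at x}"
  proof (rule ccontr)
    assume "\<not> ?thesis"
    then obtain x where x: "x \<in> E" "\<not> f differentiable at x" "v differentiable at x" "w differentiable at x"
      by auto
    obtain V W where V: "(v has_real_derivative V) (at x)" and W: "(w has_real_derivative W) (at x)"
      using x real_differentiable_def by blast
    obtain d where d: "0 < d" "ball x d \<subseteq> I"
      using I x EI by (meson openE subsetD)
    \<comment> \<open>\<open>v + w\<close> is nonnegative on \<open>I\<close> and vanishes at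
      \<open>x\<close>, so it has a local minimum there; majorant and minorant share one
      slope.\<close>
    have "V + W = 0"
    proof (rule DERIV_local_min[of "\<lambda>y. v y + w y" _ x d])
      show "((\<lambda>y. v y + w y) has_real_derivative V + W) (at x)" by (intro DERIV_add V W)
      show "\<forall>y. \<bar>x - y\<bar> < d \<longrightarrow> v x + w x \<le> v y + w y"
      proof (intro allI impI)
        fix y assume "\<bar>x - y\<bar> < d"
        then have "y \<in> I" using d by (auto simp: dist_real_def)
        then show "v x + w x \<le> v y + w y" using v(2)[of y] w(2)[of y] v(3) w(3) x by auto
      qed
    qed (use d in auto)
    then have WV: "W = - V" by simp
    have "f differentiable at x"
    proof (rule differentiable_if_nearly_linear)
      fix e :: real assume e: "0 < e"
      have "\<forall>\<^sub>F y in at x. y \<in> I"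
        by (rule eventually_at_in_open'[OF I]) (use x EI in auto)
      with has_real_derivative_approx[OF V e] has_real_derivative_approx[OF W e]
      have "\<forall>\<^sub>F y in at x. \<bar>f y - f x - V * (y - x)\<bar> \<le> e * \<bar>y - x\<bar>"
      proof eventually_elim
        case (elim y)
        then show ?case using v(2)[of y] w(2)[of y] v(3)[OF x(1)] w(3)[OF x(1)] WV
          by (simp add: abs_le_iff)
      qed
      then show "\<exists>D. \<forall>\<^sub>F y in at x. \<bar>f y - f x - D * (y - x)\<bar> \<le> e * \<bar>y - x\<bar>" by blast
    qed
    then show False using x by simp
  qed
  then show ?thesis
    using negligible_subset negligible_Un lipschitz_negligible_nondifferentiable[OF v(1)]
      lipschitz_negligible_nondifferentiable[OF w(1)] by blast
qed simp

text \<open>By the maximal inequality, almost every point satisfies a pointwise Lipschitz estimate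
  with some constant \<open>n\<close>; on each of the countably many sets \<open>E n\<close> the
  squeezing argument applies. It works in an open interval, so the two endpoints are added as a null
  set.\<close>

lemma bounded_variation_negligible_nondifferentiable:
  fixes f :: "real \<Rightarrow> real"
  assumes V: "variation_le {a..b} f V"
  shows "negligible {x\<in>{a..b}. \<not> f differentiable at x}"
proof -
  define E where "E = (\<lambda>n::nat. {x\<in>{a<..<b}. \<forall>y\<in>{a<..<b}. \<bar>f y - f x\<bar> \<le> real n * \<bar>y - x\<bar>})"
  have E: "negligible {x\<in>E n. \<not> f differentiable at x}" for n
    by (rule pointwise_lipschitz_negligible_nondifferentiable[of "real n" "{a<..<b}"])
      (auto simp: E_def)
  have R: "negligible ({a<..<b} - (\<Union>n. E n))"
    unfolding negligible_outer_le
  proof (intro allI impI)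
    fix k :: real assume k: "0 < k"
    \<comment> \<open>Large \<open>n\<close> brings the bound \<open>5 * V / n\<close> down to
      \<open>k\<close>; the absolute value makes \<open>n\<close> positive without deriving a sign
      for \<open>V\<close>.\<close>
    obtain n :: nat where n: "5 * \<bar>V\<bar> / k < real n" using reals_Archimedean2 by blast
    have "0 \<le> 5 * \<bar>V\<bar> / k" using k by simp
    with n have n0: "0 < real n" by linarith
    have "5 * V \<le> 5 * \<bar>V\<bar>" by simp
    also have "\<dots> \<le> k * real n" using n k by (simp add: field_simps)
    finally have nk: "5 * V / real n \<le> k" using n0 by (simp add: divide_le_eq)
    obtain T where T: "{x \<in> {a..b}. \<exists>y\<in>{a..b}. \<bar>f y - f x\<bar> > real n * \<bar>y - x\<bar>} \<subseteq> T"
      "T \<in> lmeasurable" "measure lebesgue T \<le> 5 * V / real n"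
      using variation_maximal_inequality[OF V n0] by blast
    have "{a<..<b} - (\<Union>n. E n) \<subseteq> T"
    proof
      fix x assume x: "x \<in> {a<..<b} - (\<Union>n. E n)"
      then have "x \<notin> E n" by blast
      then have "\<not> (\<forall>y\<in>{a<..<b}. \<bar>f y - f x\<bar> \<le> real n * \<bar>y - x\<bar>)"
        using x by (simp add: E_def)
      then obtain y where y: "y \<in> {a<..<b}" "\<not> \<bar>f y - f x\<bar> \<le> real n * \<bar>y - x\<bar>" by blast
      then have "x \<in> {x \<in> {a..b}. \<exists>y\<in>{a..b}. \<bar>f y - f x\<bar> > real n * \<bar>y - x\<bar>}"
        using x by (auto intro!: bexI[of _ y])
      then show "x \<in> T" using T(1) by blast
    qed
    then show "\<exists>T. {a<..<b} - (\<Union>n. E n) \<subseteq> T \<and> T \<in> lmeasurable \<and> measure lebesgue T \<le> k"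
      using T nk by auto
  qed
  have "negligible ({a, b} \<union> ({a<..<b} - (\<Union>n. E n)) \<union> (\<Union>n. {x\<in>E n. \<not> f differentiable at x}))"
    by (intro negligible_Un R negligible_countable_Union) (auto intro: E)
  moreover have "{x\<in>{a..b}. \<not> f differentiable at x}
      \<subseteq> {a, b} \<union> ({a<..<b} - (\<Union>n. E n)) \<union> (\<Union>n. {x\<in>E n. \<not> f differentiable at x})"
    by (auto simp: less_le)
  ultimately show ?thesis by (rule negligible_subset)
qed

section \<open>Absolutely continuous functions\<close>

lemma sum_lengths_le_measure:
  fixes x y :: "'i \<Rightarrow> real"
  assumes "finite A" and xy: "\<And>i. i \<in> A \<Longrightarrow> x i \<le> y i" "\<And>i. i \<in> A \<Longrightarrow> {x i<..<y i} \<subseteq> S"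
    and disj: "disjoint_family_on (\<lambda>i. {x i<..<y i}) A" and S: "S \<in> lmeasurable"
  shows "(\<Sum>i\<in>A. y i - x i) \<le> measure lebesgue S"
proof -
  have "(\<Sum>i\<in>A. y i - x i) = (\<Sum>i\<in>A. measure lebesgue {x i<..<y i})"
    using xy by (intro sum.cong) auto
  also have "\<dots> = measure lebesgue (\<Union>i\<in>A. {x i<..<y i})"
    by (rule measure_negligible_finite_Union_image[symmetric, OF \<open>finite A\<close>])
      (use disj in \<open>auto simp: pairwise_def disjoint_family_on_def\<close>)
  also have "\<dots> \<le> measure lebesgue S"
    using xy S \<open>finite A\<close> by (intro measure_mono_fmeasurable) auto
  finally show ?thesis .
qed

text \<open>Numbering the index set by \<open>{..<card A}\<close> reduces this to the definition.
  Later families are indexed by endpoint pairs or by tagged cells.\<close>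

lemma absolutely_continuous_on_family:
  assumes f: "absolutely_continuous_on I f" and e: "0 < e"
  shows "\<exists>\<delta>>0. \<forall>(A::'i set) x y. finite A \<longrightarrow> (\<forall>i\<in>A. x i \<le> y i \<and> {x i..y i} \<subseteq> I) \<longrightarrow>
      disjoint_family_on (\<lambda>i. {x i<..<y i}) A \<longrightarrow> (\<Sum>i\<in>A. y i - x i) < \<delta> \<longrightarrow>
      (\<Sum>i\<in>A. \<bar>f (y i) - f (x i)\<bar>) < e"
proof -
  obtain \<delta> where "0 < \<delta>" and \<delta>: "\<forall>(n::nat) x y. (\<forall>i<n. x i \<le> y i \<and> {x i..y i} \<subseteq> I) \<longrightarrow>
        disjoint_family_on (\<lambda>i. {x i<..<y i}) {..<n} \<longrightarrow>
        (\<Sum>i<n. y i - x i) < \<delta> \<longrightarrow> (\<Sum>i<n. \<bar>f (y i) - f (x i)\<bar>) < e"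
    using f[unfolded absolutely_continuous_on_def, THEN spec, THEN mp, OF e] by (elim exE conjE)
  have "(\<Sum>i\<in>A. \<bar>f (y i) - f (x i)\<bar>) < e"
    if A: "finite A" "\<forall>i\<in>A. x i \<le> y i \<and> {x i..y i} \<subseteq> I"
      "disjoint_family_on (\<lambda>i. {x i<..<y i}) A" "(\<Sum>i\<in>A. y i - x i) < \<delta>"
    for A :: "'i set" and x y
  proof -
    obtain h where h: "bij_betw h {..<card A} A"
      using ex_bij_betw_nat_finite[OF A(1)] by (auto simp: atLeast0LessThan)
    then have hA: "h i \<in> A" if "i < card A" for i using that by (auto dest: bij_betwE)
    have "(\<Sum>i<card A. \<bar>f (y (h i)) - f (x (h i))\<bar>) < e"
    proof (rule \<delta>[rule_format])
      show "disjoint_family_on (\<lambda>i. {x (h i)<..<y (h i)}) {..<card A}"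
        unfolding disjoint_family_on_def
      proof (intro ballI impI)
        fix i j assume "i \<in> {..<card A}" "j \<in> {..<card A}" "i \<noteq> j"
        then have "h i \<noteq> h j" "h i \<in> A" "h j \<in> A"
          using h hA by (auto simp: bij_betw_def inj_on_def)
        then show "{x (h i)<..<y (h i)} \<inter> {x (h j)<..<y (h j)} = {}"
          using A(3) unfolding disjoint_family_on_def by blast
      qed
      show "(\<Sum>i<card A. y (h i) - x (h i)) < \<delta>"
        using A(4) sum.reindex_bij_betw[OF h, of "\<lambda>i. y i - x i"] by simp
    qed (use A(2) hA in auto)
    then show ?thesis
      using sum.reindex_bij_betw[OF h, of "\<lambda>i. \<bar>f (y i) - f (x i)\<bar>"] by simp
  qed
  with \<open>0 < \<delta>\<close> show ?thesis by blast
qed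

lemma absolutely_continuous_on_subset:
  assumes "absolutely_continuous_on I f" "J \<subseteq> I"
  shows "absolutely_continuous_on J f"
  using assms unfolding absolutely_continuous_on_def by (meson order_trans)

lemma absolutely_continuous_on_two_points:
  assumes f: "absolutely_continuous_on I f" and e: "0 < e"
  shows "\<exists>\<delta>>0. \<forall>x y. x \<le> y \<longrightarrow> {x..y} \<subseteq> I \<longrightarrow> y - x < \<delta> \<longrightarrow> \<bar>f y - f x\<bar> < e"
proof -
  obtain \<delta> where "0 < \<delta>" and \<delta>: "\<forall>(A::unit set) x y. finite A \<longrightarrow> (\<forall>i\<in>A. x i \<le> y i \<and> {x i..y i} \<subseteq> I) \<longrightarrow>
      disjoint_family_on (\<lambda>i. {x i<..<y i}) A \<longrightarrow> (\<Sum>i\<in>A. y i - x i) < \<delta> \<longrightarrow>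
      (\<Sum>i\<in>A. \<bar>f (y i) - f (x i)\<bar>) < e"
    using absolutely_continuous_on_family[OF f e, where 'i = unit] by (elim exE conjE)
  show ?thesis
  proof (intro exI[of _ \<delta>] conjI allI impI \<open>0 < \<delta>\<close>)
    fix x y assume "x \<le> y" "{x..y} \<subseteq> I" "y - x < \<delta>"
    then show "\<bar>f y - f x\<bar> < e"
      using \<delta>[rule_format, of "{()}" "\<lambda>_. x" "\<lambda>_. y"] by (simp add: disjoint_family_on_def)
  qed
qed

lemma absolutely_continuous_on_imp_uniformly_continuous:
  assumes f: "absolutely_continuous_on I f" and I: "is_interval I"
  shows "uniformly_continuous_on I f"
  unfolding uniformly_continuous_on_def
proof (intro allI impI)
  fix e :: real assume "0 < e"
  then obtain \<delta> where \<delta>: "0 < \<delta>" "\<forall>x y. x \<le> y \<longrightarrow> {x..y} \<subseteq> I \<longrightarrow> y - x < \<delta> \<longrightarrow> \<bar>f y - f x\<bar> < e"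
    using absolutely_continuous_on_two_points[OF f] by blast
  have sub: "{x..y} \<subseteq> I" if "x \<in> I" "y \<in> I" for x y
    using mem_is_interval_1_I[OF I that] by auto
  have "dist (f y) (f x) < e" if "x \<in> I" "y \<in> I" "dist y x < \<delta>" for x y
  proof (cases "x \<le> y")
    case True
    then show ?thesis using \<delta>(2)[rule_format, of x y] sub[of x y] that by (simp add: dist_real_def)
  next
    case False
    then show ?thesis using \<delta>(2)[rule_format, of y x] sub[of y x] that by (simp add: dist_real_def abs_minus_commute)
  qed
  with \<delta>(1) show "\<exists>d>0. \<forall>x\<in>I. \<forall>x'\<in>I. dist x' x < d \<longrightarrow> dist (f x') (f x) < e" by blast
qed

text \<open>Nonoverlapping subintervals of a short interval have total length at most its own, which
  is below the \<open>\<delta>\<close> of absolute continuity.\<close>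

lemma absolutely_continuous_on_local_variation:
  assumes f: "absolutely_continuous_on I f" and e: "0 < e"
  shows "\<exists>\<delta>>0. \<forall>c d. {c..d} \<subseteq> I \<longrightarrow> d - c < \<delta> \<longrightarrow> variation_le {c..d} f e"
proof -
  obtain \<delta> where "0 < \<delta>" and \<delta>: "\<forall>(A::(real\<times>real) set) x y. finite A \<longrightarrow> (\<forall>i\<in>A. x i \<le> y i \<and> {x i..y i} \<subseteq> I) \<longrightarrow>
      disjoint_family_on (\<lambda>i. {x i<..<y i}) A \<longrightarrow> (\<Sum>i\<in>A. y i - x i) < \<delta> \<longrightarrow>
      (\<Sum>i\<in>A. \<bar>f (y i) - f (x i)\<bar>) < e"
    using absolutely_continuous_on_family[OF f e, where 'i = "real \<times> real"] by (elim exE conjE)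
  show ?thesis
  proof (intro exI[of _ \<delta>] conjI allI impI \<open>0 < \<delta>\<close>)
    fix c d assume cd: "{c..d} \<subseteq> I" "d - c < \<delta>"
    show "variation_le {c..d} f e"
      unfolding variation_le_def
    proof (intro allI impI)
      fix D :: "(real \<times> real) set"
      assume D: "finite D" "\<forall>(x,y)\<in>D. x \<le> y \<and> {x..y} \<subseteq> {c..d}"
        "disjoint_family_on (\<lambda>(x,y). {x<..<y}) D"
      have disj: "disjoint_family_on (\<lambda>i. {fst i<..<snd i}) D"
        using D(3) by (simp add: case_prod_beta')
      have le: "(\<Sum>i\<in>D. snd i - fst i) \<le> measure lebesgue {c..d}"
      proof (rule sum_lengths_le_measure[OF D(1) _ _ disj])
        fix i assume "i \<in> D"
        then have *: "fst i \<le> snd i" "{fst i..snd i} \<subseteq> {c..d}" using D(2) by auto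
        then show "fst i \<le> snd i" by simp
        show "{fst i<..<snd i} \<subseteq> {c..d}" using * by auto
      qed auto
      have "(\<Sum>i\<in>D. snd i - fst i) < \<delta>"
      proof (cases "c \<le> d")
        case True
        then show ?thesis using le cd by simp
      next
        case False
        then have "measure lebesgue {c..d} = 0" by simp
        then show ?thesis using le \<open>0 < \<delta>\<close> by simp
      qed
      then have "(\<Sum>i\<in>D. \<bar>f (snd i) - f (fst i)\<bar>) < e"
        using D(2) cd(1) by (intro \<delta>[rule_format, OF D(1) _ disj]) fastforce+
      then show "(\<Sum>(x,y)\<in>D. \<bar>f y - f x\<bar>) \<le> e" by (simp add: case_prod_beta')
    qed
  qed
qed

text \<open>Negligibility is a local property, and near each point the function has variation at
  most 1.\<close>

lemma absolutely_continuous_negligible_nondifferentiable: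
  assumes f: "absolutely_continuous_on {a..b} f"
  shows "negligible {x\<in>{a..b}. \<not> f differentiable at x}"
proof (rule locally_negligible_alt[THEN iffD2], rule ballI)
  let ?S = "{x\<in>{a..b}. \<not> f differentiable at x}"
  fix x assume x: "x \<in> ?S"
  obtain \<delta> where \<delta>: "0 < \<delta>" "\<forall>c d. {c..d} \<subseteq> {a..b} \<longrightarrow> d - c < \<delta> \<longrightarrow> variation_le {c..d} f 1"
    using absolutely_continuous_on_local_variation[OF f zero_less_one] by (elim exE conjE)
  \<comment> \<open>With radius \<open>\<delta>/3\<close> the window is at most
    \<open>2 * \<delta> / 3\<close> long, hence shorter than \<open>\<delta>\<close>.\<close>
  define c d where "c = max a (x - \<delta>/3)" and "d = min b (x + \<delta>/3)"
  have "{c..d} \<subseteq> {a..b}" "d - c < \<delta>"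
    using \<delta>(1) by (simp add: c_def d_def, simp add: c_def d_def min_def max_def)
  then have "variation_le {c..d} f 1" by (rule \<delta>(2)[rule_format])
  then have "negligible {x\<in>{c..d}. \<not> f differentiable at x}"
    by (rule bounded_variation_negligible_nondifferentiable)
  moreover have "?S \<inter> ball x (\<delta>/3) \<subseteq> {x\<in>{c..d}. \<not> f differentiable at x}"
  proof
    fix y assume y: "y \<in> ?S \<inter> ball x (\<delta>/3)"
    then have "\<bar>x - y\<bar> < \<delta>/3" by (simp add: dist_real_def)
    then have "x - \<delta>/3 \<le> y" "y \<le> x + \<delta>/3" by linarith+
    then show "y \<in> {x\<in>{c..d}. \<not> f differentiable at x}" using y by (simp add: c_def d_def)
  qed
  ultimately have "negligible (?S \<inter> ball x (\<delta>/3))" by (rule negligible_subset)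
  moreover have "openin (top_of_set ?S) (?S \<inter> ball x (\<delta>/3))"
    by (rule openin_open_Int) (rule open_ball)
  moreover have "x \<in> ?S \<inter> ball x (\<delta>/3)" using x \<delta>(1) by simp
  ultimately show "\<exists>U. openin (top_of_set ?S) U \<and> x \<in> U \<and> negligible U"
    by (intro exI conjI)
qed

section \<open>The fundamental theorem of calculus\<close>

text \<open>The gauge treats two kinds of tags. Where \<open>f\<close> is differentiable, the cell
  is small enough for the linear approximation; for tags in the null set \<open>N\<close>, it lies
  inside an open set of small measure, over which absolute continuity makes the increments of
  \<open>f\<close> small.\<close>

lemma absolutely_continuous_has_integral_deriv:
  assumes f: "absolutely_continuous_on {a..b} f" and ab: "a \<le> b"
  shows "(deriv f has_integral f b - f a) {a..b}"
proof -
  define N where "N = {x\<in>{a..b}. \<not> f differentiable at x}"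
  have N: "negligible N"
    unfolding N_def by (rule absolutely_continuous_negligible_nondifferentiable[OF f])
  \<comment> \<open>Zero on \<open>N\<close>, so that cells tagged there contribute only their
    increment of \<open>f\<close> to the error.\<close>
  define g where "g = (\<lambda>x. if x \<in> N then 0 else deriv f x)"
  have "(g has_integral f b - f a) {a..b}"
    unfolding has_integral_real
  proof (intro allI impI)
    fix e :: real assume "0 < e"
    \<comment> \<open>The cells tagged outside \<open>N\<close> will cost at most
      \<open>e1 * (b - a)\<close>; the summand 1 covers the case \<open>a = b\<close>.\<close>
    define e1 where "e1 = e / (2 * (b - a + 1))"
    have e1: "0 < e1" "e1 * (b - a) < e / 2"
      using \<open>0 < e\<close> ab by (simp_all add: e1_def field_simps)
    obtain \<delta> where "0 < \<delta>" and \<delta>: "\<forall>(A::(real\<times>real set) set) x y. finite A \<longrightarrow>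
        (\<forall>i\<in>A. x i \<le> y i \<and> {x i..y i} \<subseteq> {a..b}) \<longrightarrow>
        disjoint_family_on (\<lambda>i. {x i<..<y i}) A \<longrightarrow> (\<Sum>i\<in>A. y i - x i) < \<delta> \<longrightarrow>
        (\<Sum>i\<in>A. \<bar>f (y i) - f (x i)\<bar>) < e / 2"
      using absolutely_continuous_on_family[OF f half_gt_zero[OF \<open>0 < e\<close>], where 'i = "real \<times> real set"] by (elim exE conjE)
    obtain U where U: "open U" "N \<subseteq> U" "U \<in> lmeasurable" "measure lebesgue U < \<delta>"
    proof -
      obtain T where T: "open T" "N \<subseteq> T" "(T - N) \<in> lmeasurable" "emeasure lebesgue (T - N) < ennreal \<delta>"
        using sets_lebesgue_outer_open[OF negligible_imp_sets[OF N] \<open>0 < \<delta>\<close>] by blast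
      have Te: "T = (T - N) \<union> N" using T by blast
      have "T \<in> lmeasurable"
        by (subst Te) (intro fmeasurable.Un T negligible_imp_measurable N)
      moreover have "measure lebesgue T = measure lebesgue (T - N)"
        using N T(3) by (subst Te) (intro measure_Un_null_set, auto simp: negligible_iff_null_sets)
      moreover have "measure lebesgue (T - N) < \<delta>"
        using T(4) \<open>0 < \<delta>\<close> emeasure_eq_measure2[OF T(3)] by (simp add: ennreal_less_iff)
      ultimately show thesis using that T by auto
    qed
    have "\<exists>r>0. (x \<in> N \<longrightarrow> ball x r \<subseteq> U) \<and>
        (x \<in> {a..b} - N \<longrightarrow> (\<forall>y\<in>ball x r. \<bar>f y - f x - deriv f x * (y - x)\<bar> \<le> e1 * \<bar>y - x\<bar>))" for x
    proof (cases "x \<in> N")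
      case True
      then show ?thesis using U openE by (metis DiffD2 subsetD)
    next
      case False
      show ?thesis
      proof (cases "x \<in> {a..b}")
        case True
        then have "f differentiable at x" using False by (simp add: N_def)
        then have "(f has_real_derivative deriv f x) (at x)"
          by (simp add: DERIV_deriv_iff_real_differentiable)
        from has_real_derivative_approx[OF this e1(1)]
        obtain r where "0 < r" "\<And>y. y \<noteq> x \<Longrightarrow> dist y x < r \<Longrightarrow> \<bar>f y - f x - deriv f x * (y - x)\<bar> \<le> e1 * \<bar>y - x\<bar>"
          unfolding eventually_at by blast
        then have "\<forall>y\<in>ball x r. \<bar>f y - f x - deriv f x * (y - x)\<bar> \<le> e1 * \<bar>y - x\<bar>"
          by (metis dist_commute mem_ball abs_zero diff_self mult_zero_right order_refl)
        then show ?thesis using \<open>0 < r\<close> False by blast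
      qed (use False in \<open>auto intro: zero_less_one\<close>)
    qed
    then obtain r where r: "\<And>x. 0 < r x" "\<And>x. x \<in> N \<Longrightarrow> ball x (r x) \<subseteq> U"
      "\<And>x y. x \<in> {a..b} - N \<Longrightarrow> y \<in> ball x (r x) \<Longrightarrow> \<bar>f y - f x - deriv f x * (y - x)\<bar> \<le> e1 * \<bar>y - x\<bar>"
      by metis
    show "\<exists>\<gamma>. gauge \<gamma> \<and> (\<forall>\<D>. \<D> tagged_division_of {a..b} \<and> \<gamma> fine \<D> \<longrightarrow>
        norm ((\<Sum>(x, k)\<in>\<D>. measure lborel k *\<^sub>R g x) - (f b - f a)) < e)"
    proof (intro exI conjI allI impI)
      show "gauge (\<lambda>x. ball x (r x))" using r(1) by (simp add: gauge_ball_dependent)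
      fix p assume p: "p tagged_division_of {a..b} \<and> (\<lambda>x. ball x (r x)) fine p"
      then have td: "p tagged_division_of {a..b}" and fine: "(\<lambda>x. ball x (r x)) fine p" by auto
      have fin: "finite p" using td by (rule tagged_division_of_finite)
      have K: "K = {Inf K..Sup K} \<and> Inf K \<le> x \<and> x \<le> Sup K \<and> {Inf K..Sup K} \<subseteq> {a..b} \<and> {Inf K..Sup K} \<subseteq> ball x (r x)"
        if xK: "(x,K) \<in> p" for x K
      proof -
        obtain u v where uv: "K = cbox u v" using tagged_division_ofD(4)[OF td xK] by blast
        have "x \<in> K" using tagged_division_ofD(2)[OF td xK] .
        moreover have "K \<subseteq> {a..b}" using tagged_division_ofD(3)[OF td xK] .
        moreover have "K \<subseteq> ball x (r x)" using fine xK by (auto simp: fine_def)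
        ultimately show ?thesis using uv by (auto simp: box_real)
      qed
      have c: "measure lborel K = Sup K - Inf K" if "(x,K) \<in> p" for x K
      proof -
        have "Inf K \<le> Sup K" using K[OF that] by linarith
        then have "measure lborel {Inf K..Sup K} = Sup K - Inf K" by simp
        then show ?thesis using K[OF that] by simp
      qed
      let ?A = "{i\<in>p. fst i \<in> N}"
      have disj: "disjoint_family_on (\<lambda>i. {Inf (snd i)<..<Sup (snd i)}) ?A"
        unfolding disjoint_family_on_def
      proof (intro ballI impI)
        fix i j assume ij: "i \<in> ?A" "j \<in> ?A" "i \<noteq> j"
        obtain x K y L where e: "i = (x,K)" "j = (y,L)" by (cases i, cases j)
        have "interior K \<inter> interior L = {}"
          using tagged_division_ofD(5)[OF td, of x K y L] ij e by auto
        moreover have "interior K = {Inf K<..<Sup K}" "interior L = {Inf L<..<Sup L}"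
          using K[of x K] K[of y L] ij e interior_atLeastAtMost_real[of "Inf K" "Sup K"] interior_atLeastAtMost_real[of "Inf L" "Sup L"]
          by auto
        ultimately show "{Inf (snd i)<..<Sup (snd i)} \<inter> {Inf (snd j)<..<Sup (snd j)} = {}"
          by (simp add: e)
      qed
      have KA: "Inf (snd i) \<le> Sup (snd i) \<and> {Inf (snd i)..Sup (snd i)} \<subseteq> {a..b} \<and> {Inf (snd i)<..<Sup (snd i)} \<subseteq> U"
        if "i \<in> ?A" for i
      proof -
        obtain x L where i: "i = (x,L)" by (cases i)
        have "(x,L) \<in> p" "x \<in> N" using that i by auto
        note k = K[OF this(1)] and u = r(2)[OF this(2)]
        have "{Inf L<..<Sup L} \<subseteq> {Inf L..Sup L}" by auto
        then have "{Inf L<..<Sup L} \<subseteq> U" using k u by blast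
        then show ?thesis unfolding i snd_conv using k order_trans[of "Inf L" x "Sup L"] by blast
      qed
      have "(\<Sum>i\<in>?A. \<bar>f (Sup (snd i)) - f (Inf (snd i))\<bar>) < e / 2"
      proof (rule \<delta>[rule_format, OF _ _ disj])
        have "(\<Sum>i\<in>?A. Sup (snd i) - Inf (snd i)) \<le> measure lebesgue U"
          by (rule sum_lengths_le_measure[OF _ _ _ disj U(3)]) (use fin KA in auto)
        then show "(\<Sum>i\<in>?A. Sup (snd i) - Inf (snd i)) < \<delta>" using U(4) by linarith
      qed (use fin KA in auto)
      moreover have "(\<Sum>i\<in>p - ?A. \<bar>measure lborel (snd i) * g (fst i) - (f (Sup (snd i)) - f (Inf (snd i)))\<bar>) \<le> e1 * (b - a)"
      proof -
        have "(\<Sum>i\<in>p - ?A. \<bar>measure lborel (snd i) * g (fst i) - (f (Sup (snd i)) - f (Inf (snd i)))\<bar>)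
            \<le> (\<Sum>i\<in>p - ?A. e1 * measure lborel (snd i))"
        proof (rule sum_mono)
          fix i assume "i \<in> p - ?A"
          then obtain x L where i: "i = (x,L)" and xL: "(x,L) \<in> p" "x \<notin> N" by (cases i) auto
          note k = K[OF xL(1)]
          have "x \<in> {a..b} - N" using k xL by auto
          note rx = r(3)[OF this]
          have le: "Inf L \<le> Sup L" using k by linarith
          have "{Inf L..Sup L} \<subseteq> ball x (r x)" using k by blast
          moreover have "Inf L \<in> {Inf L..Sup L}" "Sup L \<in> {Inf L..Sup L}" using le by auto
          ultimately have "Inf L \<in> ball x (r x)" "Sup L \<in> ball x (r x)" by blast+
          \<comment> \<open>The tag lies between the endpoints, so the errors at the two ends
            combine to \<open>e1\<close> times the length of the cell (the straddle lemma).\<close>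
          then have "\<bar>f (Sup L) - f x - deriv f x * (Sup L - x)\<bar> \<le> e1 * (Sup L - x)"
            "\<bar>f (Inf L) - f x - deriv f x * (Inf L - x)\<bar> \<le> e1 * (x - Inf L)"
            using rx[of "Sup L"] rx[of "Inf L"] k by (simp_all only: abs_of_nonneg abs_of_nonpos diff_ge_0_iff_ge diff_le_0_iff_le minus_diff_eq)
          moreover have "(Sup L - Inf L) * deriv f x - (f (Sup L) - f (Inf L))
            = (f (Inf L) - f x - deriv f x * (Inf L - x)) - (f (Sup L) - f x - deriv f x * (Sup L - x))"
            by (simp add: algebra_simps)
          moreover have "e1 * (Sup L - Inf L) = e1 * (Sup L - x) + e1 * (x - Inf L)" by (simp add: algebra_simps)
          ultimately have "\<bar>(Sup L - Inf L) * deriv f x - (f (Sup L) - f (Inf L))\<bar> \<le> e1 * (Sup L - Inf L)"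
            by linarith
          then show "\<bar>measure lborel (snd i) * g (fst i) - (f (Sup (snd i)) - f (Inf (snd i)))\<bar> \<le> e1 * measure lborel (snd i)"
            using c[OF xL(1)] xL by (simp add: i g_def)
        qed
        also have "\<dots> \<le> (\<Sum>i\<in>p. e1 * measure lborel (snd i))"
          using fin e1(1) by (intro sum_mono2) auto
        also have "\<dots> = e1 * (\<Sum>(x,K)\<in>p. measure lborel K)" by (simp add: sum_distrib_left case_prod_beta')
        also have "(\<Sum>(x,K)\<in>p. measure lborel K) = b - a"
          using additive_content_tagged_division[of p a b] td ab by (simp add: box_real)
        finally show ?thesis .
      qed
      \<comment> \<open>\<open>f b - f a\<close> telescopes over the division, so the whole error is
        a sum of errors of single cells.\<close>
      moreover have "(\<Sum>(x, k)\<in>p. measure lborel k *\<^sub>R g x) - (f b - f a)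
        = (\<Sum>i\<in>p. measure lborel (snd i) * g (fst i) - (f (Sup (snd i)) - f (Inf (snd i))))"
        unfolding additive_tagged_division_1[OF ab td, of f, symmetric]
        by (simp add: sum_subtractf case_prod_beta')
      moreover have "\<bar>\<Sum>i\<in>p. measure lborel (snd i) * g (fst i) - (f (Sup (snd i)) - f (Inf (snd i)))\<bar>
          \<le> (\<Sum>i\<in>p. \<bar>measure lborel (snd i) * g (fst i) - (f (Sup (snd i)) - f (Inf (snd i)))\<bar>)"
        by (rule sum_abs)
      moreover have "(\<Sum>i\<in>p. \<bar>measure lborel (snd i) * g (fst i) - (f (Sup (snd i)) - f (Inf (snd i)))\<bar>)
        = (\<Sum>i\<in>p - ?A. \<bar>measure lborel (snd i) * g (fst i) - (f (Sup (snd i)) - f (Inf (snd i)))\<bar>)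
          + (\<Sum>i\<in>?A. \<bar>measure lborel (snd i) * g (fst i) - (f (Sup (snd i)) - f (Inf (snd i)))\<bar>)"
        using fin by (intro sum.subset_diff) auto
      moreover have "(\<Sum>i\<in>?A. \<bar>measure lborel (snd i) * g (fst i) - (f (Sup (snd i)) - f (Inf (snd i)))\<bar>)
        = (\<Sum>i\<in>?A. \<bar>f (Sup (snd i)) - f (Inf (snd i))\<bar>)"
        by (intro sum.cong) (auto simp: g_def)
      ultimately show "norm ((\<Sum>(x, k)\<in>p. measure lborel k *\<^sub>R g x) - (f b - f a)) < e"
        using e1(2) by (simp only: real_norm_def)
    qed
  qed
  then show ?thesis
    by (rule has_integral_spike[OF N, rotated]) (simp add: g_def)
qed

text \<open>The integral of \<open>deriv f\<close> over a cell is the increment of \<open>f\<close>,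
  so the sums of absolute values of integrals over divisions are variation sums of \<open>f\<close>;
  their boundedness upgrades gauge integrability to absolute integrability.\<close>

lemma absolutely_continuous_absolutely_integrable_deriv_local:
  assumes f: "absolutely_continuous_on {a..b} f" and V: "variation_le {a..b} f V"
  shows "deriv f absolutely_integrable_on {a..b}"
proof (cases "a \<le> b")
  case True
  have int: "integral {u..v} (deriv f) = f v - f u" if "a \<le> u" "u \<le> v" "v \<le> b" for u v
    by (intro integral_unique absolutely_continuous_has_integral_deriv
        absolutely_continuous_on_subset[OF f]) (use that in auto)
  have "deriv f absolutely_integrable_on cbox a b"
  proof (rule bounded_variation_absolutely_integrable_interval)
    show "deriv f integrable_on cbox a b"
      using absolutely_continuous_has_integral_deriv[OF f True] by (auto simp: box_real)
    fix d assume d: "d division_of cbox a b"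
    let ?h = "\<lambda>K::real set. (Inf K, Sup K)"
    have K: "{Inf K..Sup K} = K \<and> Inf K \<le> Sup K \<and> a \<le> Inf K \<and> Sup K \<le> b" if Kd: "K \<in> d" for K
    proof -
      obtain u v where uv: "K = cbox u v" using division_ofD(4)[OF d Kd] by blast
      moreover have "K \<noteq> {}" "K \<subseteq> cbox a b" using division_ofD(2,3)[OF d Kd] by auto
      ultimately show ?thesis by (auto simp: box_real)
    qed
    \<comment> \<open>The sum over cells becomes one over endpoint pairs; no terms merge, since a
      cell is determined by its endpoints.\<close>
    have inj: "inj_on ?h d"
    proof (rule inj_onI)
      fix K L assume KL: "K \<in> d" "L \<in> d" "?h K = ?h L"
      have "K = {Inf K..Sup K}" using K[OF KL(1)] by (simp only:)
      also have "\<dots> = {Inf L..Sup L}" using KL(3) by (simp only: prod.inject)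
      also have "\<dots> = L" using K[OF KL(2)] by (simp only:)
      finally show "K = L" .
    qed
    have "(\<Sum>K\<in>d. norm (integral K (deriv f))) = (\<Sum>K\<in>d. \<bar>f (Sup K) - f (Inf K)\<bar>)"
    proof (rule sum.cong)
      fix K assume "K \<in> d"
      then show "norm (integral K (deriv f)) = \<bar>f (Sup K) - f (Inf K)\<bar>"
        using K[of K] int[of "Inf K" "Sup K"] by (simp only: real_norm_def)
    qed simp
    also have "\<dots> = (\<Sum>(x,y)\<in>?h ` d. \<bar>f y - f x\<bar>)"
      by (subst sum.reindex[OF inj]) simp
    also have "\<dots> \<le> V"
    proof (rule variation_leD[OF V])
      show "finite (?h ` d)" using d by auto
      show "x \<le> y \<and> {x..y} \<subseteq> {a..b}" if "(x,y) \<in> ?h ` d" for x y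
        using that K by auto
      show "disjoint_family_on (\<lambda>(x,y). {x<..<y}) (?h ` d)"
        unfolding disjoint_family_on_def
      proof (intro ballI impI)
        fix i j assume ij: "i \<in> ?h ` d" "j \<in> ?h ` d" "i \<noteq> j"
        then obtain K L where KL: "i = ?h K" "j = ?h L" "K \<in> d" "L \<in> d" "K \<noteq> L" by auto
        have "interior K \<inter> interior L = {}" by (rule division_ofD(5)[OF d KL(3-5)])
        moreover have "interior K = {Inf K<..<Sup K}" "interior L = {Inf L<..<Sup L}"
          using K[OF KL(3)] K[OF KL(4)] interior_atLeastAtMost_real[of "Inf K" "Sup K"] interior_atLeastAtMost_real[of "Inf L" "Sup L"]
          by simp_all
        ultimately show "(case i of (x,y) \<Rightarrow> {x<..<y}) \<inter> (case j of (x,y) \<Rightarrow> {x<..<y}) = {}"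
          by (simp only: KL prod.case)
      qed
    qed
    finally show "(\<Sum>K\<in>d. norm (integral K (deriv f))) \<le> V" .
  qed
  then show ?thesis by (simp add: box_real)
qed simp

text \<open>Absolute continuity bounds the variation directly only on short intervals, so finitely
  many pieces of variation at most 1 are joined one after another.\<close>

lemma absolutely_continuous_absolutely_integrable_deriv:
  assumes f: "absolutely_continuous_on {a..b} f"
  shows "deriv f absolutely_integrable_on {a..b}"
proof -
  obtain \<delta> where \<delta>: "0 < \<delta>" "\<forall>c d. {c..d} \<subseteq> {a..b} \<longrightarrow> d - c < \<delta> \<longrightarrow> variation_le {c..d} f 1"
    using absolutely_continuous_on_local_variation[OF f zero_less_one] by (elim exE conjE)
  have piece: "deriv f absolutely_integrable_on {c..d}" if "{c..d} \<subseteq> {a..b}" "d - c < \<delta>" for c d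
    by (rule absolutely_continuous_absolutely_integrable_deriv_local
        [OF absolutely_continuous_on_subset[OF f that(1)] \<delta>(2)[rule_format, OF that]])
  \<comment> \<open>Each step appends a piece of length at most \<open>\<delta>/2\<close>;
    \<open>min b\<close> stops the growth at \<open>b\<close>, which is reached after finitely many
    steps.\<close>
  have step: "deriv f absolutely_integrable_on {a..min b (a + real n * (\<delta>/2))}" for n
  proof (induction n)
    case 0
    show ?case by (rule piece) (use \<delta>(1) in auto)
  next
    case (Suc n)
    define q where "q = a + real n * (\<delta>/2)"
    have q: "a \<le> q" "a + real (Suc n) * (\<delta>/2) = q + \<delta>/2"
      using \<delta>(1) by (simp_all add: q_def algebra_simps)
    show ?case
    proof (cases "a \<le> b")
      case True
      have "deriv f absolutely_integrable_on {min b q..min b (q + \<delta>/2)}"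
      proof (rule piece)
        show "min b (q + \<delta>/2) - min b q < \<delta>"
          using \<delta>(1) by (simp add: min_def)
      qed (use True q(1) in simp)
      then have "deriv f absolutely_integrable_on ({a..min b q} \<union> {min b q..min b (q + \<delta>/2)})"
        using Suc unfolding q_def[symmetric] by (intro absolutely_integrable_Un)
      moreover have "{a..min b q} \<union> {min b q..min b (q + \<delta>/2)} = {a..min b (q + \<delta>/2)}"
        using True q(1) \<delta>(1) by (intro ivl_disj_un_two_touch) (auto simp: min_def)
      ultimately show ?thesis by (simp only: q)
    next
      case False
      then have "{a..min b (a + real (Suc n) * (\<delta>/2))} = {}" by (simp add: min_def)
      then show ?thesis by (simp only: set_integrable_empty)
    qed
  qed
  obtain n :: nat where "(b - a) / (\<delta>/2) < real n" using reals_Archimedean2 by blast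
  then have "min b (a + real n * (\<delta>/2)) = b" using \<delta>(1) by (simp add: field_simps)
  with step[of n] show ?thesis by simp
qed

section \<open>Products and integration by parts\<close>

lemma lipschitz_imp_absolutely_continuous_on:
  fixes g :: "real \<Rightarrow> real"
  assumes L: "0 < L" and g: "\<And>x y. x \<in> I \<Longrightarrow> y \<in> I \<Longrightarrow> \<bar>g y - g x\<bar> \<le> L * \<bar>y - x\<bar>"
  shows "absolutely_continuous_on I g"
  unfolding absolutely_continuous_on_def
proof (intro allI impI)
  fix e :: real assume e: "0 < e"
  show "\<exists>\<delta>>0. \<forall>(n::nat) x y. (\<forall>i<n. x i \<le> y i \<and> {x i..y i} \<subseteq> I) \<longrightarrow>
        disjoint_family_on (\<lambda>i. {x i<..<y i}) {..<n} \<longrightarrow>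
        (\<Sum>i<n. y i - x i) < \<delta> \<longrightarrow> (\<Sum>i<n. \<bar>g (y i) - g (x i)\<bar>) < e"
  proof (intro exI[of _ "e / L"] conjI allI impI)
    fix n :: nat and x y :: "nat \<Rightarrow> real"
    assume xy: "\<forall>i<n. x i \<le> y i \<and> {x i..y i} \<subseteq> I" and sum: "(\<Sum>i<n. y i - x i) < e / L"
    have "(\<Sum>i<n. \<bar>g (y i) - g (x i)\<bar>) \<le> (\<Sum>i<n. L * (y i - x i))"
    proof (rule sum_mono)
      fix i assume "i \<in> {..<n}"
      then have *: "x i \<le> y i" "{x i..y i} \<subseteq> I" using xy by auto
      then have "x i \<in> I" "y i \<in> I" by auto
      then show "\<bar>g (y i) - g (x i)\<bar> \<le> L * (y i - x i)" using g[of "x i" "y i"] *(1) by simp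
    qed
    also have "\<dots> = L * (\<Sum>i<n. y i - x i)" by (simp only: sum_distrib_left)
    also have "\<dots> < e" using sum L by (simp add: field_simps)
    finally show "(\<Sum>i<n. \<bar>g (y i) - g (x i)\<bar>) < e" .
  qed (use e L in simp)
qed

lemma absolutely_continuous_on_mult:
  assumes f: "absolutely_continuous_on {a..b} f" and g: "absolutely_continuous_on {a..b} g"
  shows "absolutely_continuous_on {a..b} (\<lambda>x. f x * g x)"
proof -
  have "\<exists>B>0. \<forall>x\<in>{a..b}. \<bar>h x\<bar> \<le> B" if "absolutely_continuous_on {a..b} h" for h
  proof -
    have "continuous_on {a..b} h"
      by (intro uniformly_continuous_imp_continuous absolutely_continuous_on_imp_uniformly_continuous that)
        (rule is_interval_cc)
    then have "bounded (h ` {a..b})"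
      by (intro compact_imp_bounded compact_continuous_image) auto
    then show ?thesis by (auto simp: bounded_pos)
  qed
  from this[OF f] this[OF g] obtain B C where B: "0 < B" "\<forall>x\<in>{a..b}. \<bar>f x\<bar> \<le> B"
    and C: "0 < C" "\<forall>x\<in>{a..b}. \<bar>g x\<bar> \<le> C" by blast
  show ?thesis
    unfolding absolutely_continuous_on_def
  proof (intro allI impI)
    fix e :: real assume e: "0 < e"
    \<comment> \<open>Increments of \<open>f\<close> are weighted by the bound \<open>C\<close> for
      \<open>g\<close> and vice versa, so each half of the product increment costs
      \<open>e / 2\<close>.\<close>
    then have "0 < e / (2 * C)" "0 < e / (2 * B)" using B C by simp_all
    then obtain \<delta>1 \<delta>2 where \<delta>1: "0 < \<delta>1" "\<forall>(n::nat) x y. (\<forall>i<n. x i \<le> y i \<and> {x i..y i} \<subseteq> {a..b}) \<longrightarrow>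
        disjoint_family_on (\<lambda>i. {x i<..<y i}) {..<n} \<longrightarrow>
        (\<Sum>i<n. y i - x i) < \<delta>1 \<longrightarrow> (\<Sum>i<n. \<bar>f (y i) - f (x i)\<bar>) < e / (2 * C)"
      and \<delta>2: "0 < \<delta>2" "\<forall>(n::nat) x y. (\<forall>i<n. x i \<le> y i \<and> {x i..y i} \<subseteq> {a..b}) \<longrightarrow>
        disjoint_family_on (\<lambda>i. {x i<..<y i}) {..<n} \<longrightarrow>
        (\<Sum>i<n. y i - x i) < \<delta>2 \<longrightarrow> (\<Sum>i<n. \<bar>g (y i) - g (x i)\<bar>) < e / (2 * B)"
      using f[unfolded absolutely_continuous_on_def, THEN spec, THEN mp, of "e / (2 * C)"]
        g[unfolded absolutely_continuous_on_def, THEN spec, THEN mp, of "e / (2 * B)"] by (elim exE conjE meta_impE)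
    show "\<exists>\<delta>>0. \<forall>(n::nat) x y. (\<forall>i<n. x i \<le> y i \<and> {x i..y i} \<subseteq> {a..b}) \<longrightarrow>
        disjoint_family_on (\<lambda>i. {x i<..<y i}) {..<n} \<longrightarrow>
        (\<Sum>i<n. y i - x i) < \<delta> \<longrightarrow> (\<Sum>i<n. \<bar>f (y i) * g (y i) - f (x i) * g (x i)\<bar>) < e"
    proof (intro exI[of _ "min \<delta>1 \<delta>2"] conjI allI impI)
      fix n :: nat and x y :: "nat \<Rightarrow> real"
      assume xy: "\<forall>i<n. x i \<le> y i \<and> {x i..y i} \<subseteq> {a..b}"
        and disj: "disjoint_family_on (\<lambda>i. {x i<..<y i}) {..<n}"
        and sum: "(\<Sum>i<n. y i - x i) < min \<delta>1 \<delta>2"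
      have "(\<Sum>i<n. \<bar>f (y i) * g (y i) - f (x i) * g (x i)\<bar>)
          \<le> (\<Sum>i<n. C * \<bar>f (y i) - f (x i)\<bar> + B * \<bar>g (y i) - g (x i)\<bar>)"
      proof (rule sum_mono)
        fix i assume "i \<in> {..<n}"
        then have *: "x i \<le> y i" "{x i..y i} \<subseteq> {a..b}" using xy by auto
        then have "x i \<in> {a..b}" "y i \<in> {a..b}" by auto
        then have "\<bar>g (y i)\<bar> \<le> C" "\<bar>f (x i)\<bar> \<le> B" using B C by auto
        then have "\<bar>f (y i) - f (x i)\<bar> * \<bar>g (y i)\<bar> \<le> \<bar>f (y i) - f (x i)\<bar> * C"
          "\<bar>f (x i)\<bar> * \<bar>g (y i) - g (x i)\<bar> \<le> B * \<bar>g (y i) - g (x i)\<bar>"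
          by (auto intro: mult_left_mono mult_right_mono)
        moreover have "f (y i) * g (y i) - f (x i) * g (x i)
          = (f (y i) - f (x i)) * g (y i) + f (x i) * (g (y i) - g (x i))" by (simp add: algebra_simps)
        ultimately show "\<bar>f (y i) * g (y i) - f (x i) * g (x i)\<bar>
            \<le> C * \<bar>f (y i) - f (x i)\<bar> + B * \<bar>g (y i) - g (x i)\<bar>"
          using abs_triangle_ineq[of "(f (y i) - f (x i)) * g (y i)" "f (x i) * (g (y i) - g (x i))"]
          by (simp only: abs_mult mult.commute[of C])
      qed
      also have "\<dots> = C * (\<Sum>i<n. \<bar>f (y i) - f (x i)\<bar>) + B * (\<Sum>i<n. \<bar>g (y i) - g (x i)\<bar>)"
        by (simp only: sum.distrib sum_distrib_left)
      also have "\<dots> < C * (e / (2 * C)) + B * (e / (2 * B))"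
        using \<delta>1(2)[rule_format, OF xy[rule_format] disj] \<delta>2(2)[rule_format, OF xy[rule_format] disj] sum B C
        by (intro add_strict_mono mult_strict_left_mono) auto
      also have "\<dots> = e" using B(1) C(1) by simp
      finally show "(\<Sum>i<n. \<bar>f (y i) * g (y i) - f (x i) * g (x i)\<bar>) < e" .
    qed (use \<delta>1 \<delta>2 in simp)
  qed
qed

text \<open>A function with continuous derivative is Lipschitz on the interval, so
  \<open>g * f\<close> is absolutely continuous and the fundamental theorem applies to it; the
  product rule holds off the null set where \<open>f\<close> is not differentiable.\<close>

lemma absolutely_continuous_integration_by_parts:
  assumes f: "absolutely_continuous_on {a..b} f" and ab: "a \<le> b"
    and g: "\<And>x. (g has_real_derivative g' x) (at x)" and g': "continuous_on {a..b} g'"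
  shows "(\<lambda>x. g x * deriv f x) absolutely_integrable_on {a..b}"
    and "integral {a..b} (\<lambda>x. g x * deriv f x) = g b * f b - g a * f a - integral {a..b} (\<lambda>x. g' x * f x)"
proof -
  have "bounded (g' ` {a..b})"
    by (intro compact_imp_bounded compact_continuous_image g') simp
  then obtain B where B: "0 < B" "\<And>x. x \<in> {a..b} \<Longrightarrow> \<bar>g' x\<bar> \<le> B" by (auto simp: bounded_pos)
  have "absolutely_continuous_on {a..b} g"
  proof (rule lipschitz_imp_absolutely_continuous_on[OF B(1)])
    fix x y assume "x \<in> {a..b}" "y \<in> {a..b}"
    then have "norm (g y - g x) \<le> B * norm (y - x)"
      by (intro field_differentiable_bound[of "{a..b}" g g'])
        (auto intro: has_field_derivative_at_within[OF g] B(2))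
    then show "\<bar>g y - g x\<bar> \<le> B * \<bar>y - x\<bar>" by simp
  qed
  then have gf: "absolutely_continuous_on {a..b} (\<lambda>x. g x * f x)"
    by (rule absolutely_continuous_on_mult) (rule f)
  let ?N = "{x\<in>{a..b}. \<not> f differentiable at x}"
  have N: "negligible ?N" by (rule absolutely_continuous_negligible_nondifferentiable[OF f])
  have cf: "continuous_on {a..b} f"
    by (intro uniformly_continuous_imp_continuous absolutely_continuous_on_imp_uniformly_continuous f)
      (rule is_interval_cc)
  then have cgf: "continuous_on {a..b} (\<lambda>x. g' x * f x)" using g' by (intro continuous_on_mult)
  \<comment> \<open>Equal to \<open>g * deriv f\<close> almost everywhere by the product rule, with
    both parts known to be integrable.\<close>
  let ?k = "\<lambda>x. deriv (\<lambda>x. g x * f x) x - g' x * f x"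
  have k: "?k absolutely_integrable_on {a..b}"
    by (intro set_integral_diff absolutely_continuous_absolutely_integrable_deriv[OF gf]
        absolutely_integrable_continuous_real[OF cgf])
  have eq: "g x * deriv f x = ?k x" if "x \<in> {a..b} - ?N" for x
  proof -
    have "f differentiable at x" using that by blast
    then have "(f has_real_derivative deriv f x) (at x)"
      by (simp add: DERIV_deriv_iff_real_differentiable)
    from DERIV_mult[OF g this] have "deriv (\<lambda>x. g x * f x) x = g' x * f x + deriv f x * g x"
      by (rule DERIV_imp_deriv)
    then show ?thesis by simp
  qed
  show "(\<lambda>x. g x * deriv f x) absolutely_integrable_on {a..b}"
    by (rule absolutely_integrable_spike[OF k N eq])
  have "integral {a..b} (\<lambda>x. g x * deriv f x) = integral {a..b} ?k"
    by (rule integral_spike[OF N]) (simp add: eq)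
  also have "\<dots> = integral {a..b} (deriv (\<lambda>x. g x * f x)) - integral {a..b} (\<lambda>x. g' x * f x)"
    by (intro Henstock_Kurzweil_Integration.integral_diff integrable_continuous_real[OF cgf]
        has_integral_integrable[OF absolutely_continuous_has_integral_deriv[OF gf ab]])
  also have "integral {a..b} (deriv (\<lambda>x. g x * f x)) = g b * f b - g a * f a"
    by (rule integral_unique[OF absolutely_continuous_has_integral_deriv[OF gf ab]])
  finally show "integral {a..b} (\<lambda>x. g x * deriv f x)
      = g b * f b - g a * f a - integral {a..b} (\<lambda>x. g' x * f x)" .
qed

section \<open>The limit at the left endpoint\<close>

text \<open>Uniform continuity on the open interval gives an extension to the closure. Hence
  \<open>Lim\<close>, a definite description, denotes an actual limit here.\<close>

lemma absolutely_continuous_on_Ioo_tendsto_at_right: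
  assumes f: "absolutely_continuous_on {a<..<b} f" and ab: "a < b"
  shows "(f \<longlongrightarrow> Lim (at_right a) f) (at_right a)"
proof -
  have "uniformly_continuous_on {a<..<b} f"
    by (rule absolutely_continuous_on_imp_uniformly_continuous[OF f]) (rule is_interval_oo)
  moreover have "a \<in> closure {a<..<b}" using ab by simp
  ultimately obtain l where "(f \<longlongrightarrow> l) (at a within {a<..<b})"
    by (rule uniformly_continuous_on_extension_at_closure)
  moreover have "at a within {a<..<b} = at_right a"
    by (rule at_within_nhd[of a "{..<b}"]) (use ab in auto)
  ultimately have "(f \<longlongrightarrow> l) (at_right a)" by simp
  moreover from this have "Lim (at_right a) f = l" by (intro tendsto_Lim) simp
  ultimately show ?thesis by simp
qed

text \<open>The fundamental theorem is stated on closed intervals, while \<open>f a\<close> is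
  arbitrary; the limit replaces it. Intervals are clipped at \<open>s > a\<close>, where the
  hypothesis applies, and then \<open>s\<close> tends to \<open>a\<close>.\<close>

lemma absolutely_continuous_on_Icc_extension:
  assumes f: "absolutely_continuous_on {a<..<b} f" and t: "a < t" "t < b"
  shows "absolutely_continuous_on {a..t} (\<lambda>x. if x \<le> a then Lim (at_right a) f else f x)"
proof -
  define F where "F = (\<lambda>x. if x \<le> a then Lim (at_right a) f else f x)"
  have lim: "(f \<longlongrightarrow> Lim (at_right a) f) (at_right a)"
    by (rule absolutely_continuous_on_Ioo_tendsto_at_right[OF f]) (use t in simp)
  have s: "\<forall>\<^sub>F s in at_right a. a < s \<and> s < t"
    using t(1) by (auto simp: eventually_at_right_field)
  \<comment> \<open>At \<open>z = a\<close> this is the one-sided limit; for \<open>z > a\<close>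
    the value is eventually constant in \<open>s\<close>.\<close>
  have Flim: "((\<lambda>s. F (max s z)) \<longlongrightarrow> F z) (at_right a)" if "a \<le> z" for z
  proof (cases "z = a")
    case True
    have "\<forall>\<^sub>F s in at_right a. f s = F (max s z)"
      using s by eventually_elim (simp add: True F_def)
    with lim have "((\<lambda>s. F (max s z)) \<longlongrightarrow> Lim (at_right a) f) (at_right a)"
      by (rule Lim_transform_eventually)
    then show ?thesis by (simp add: True F_def)
  next
    case False
    then have "\<forall>\<^sub>F s in at_right a. a < s \<and> s < z"
      unfolding eventually_at_right_field using that by (intro exI[of _ z]) auto
    then have "\<forall>\<^sub>F s in at_right a. F z = F (max s z)"
      by eventually_elim (simp add: max_def)
    then show ?thesis by (rule Lim_transform_eventually[OF tendsto_const])
  qed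
  have "absolutely_continuous_on {a..t} F"
    unfolding absolutely_continuous_on_def
  proof (intro allI impI)
    fix e :: real assume e: "0 < e"
    \<comment> \<open>\<open>e / 2\<close> leaves room, since the limit in \<open>s\<close>
      preserves only a weak inequality.\<close>
    then obtain \<delta> where \<delta>: "0 < \<delta>" "\<forall>(n::nat) x y. (\<forall>i<n. x i \<le> y i \<and> {x i..y i} \<subseteq> {a<..<b}) \<longrightarrow>
        disjoint_family_on (\<lambda>i. {x i<..<y i}) {..<n} \<longrightarrow>
        (\<Sum>i<n. y i - x i) < \<delta> \<longrightarrow> (\<Sum>i<n. \<bar>f (y i) - f (x i)\<bar>) < e / 2"
      using f[unfolded absolutely_continuous_on_def, THEN spec, THEN mp, OF half_gt_zero[OF e]]
      by (elim exE conjE)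
    show "\<exists>\<delta>>0. \<forall>(n::nat) x y. (\<forall>i<n. x i \<le> y i \<and> {x i..y i} \<subseteq> {a..t}) \<longrightarrow>
        disjoint_family_on (\<lambda>i. {x i<..<y i}) {..<n} \<longrightarrow>
        (\<Sum>i<n. y i - x i) < \<delta> \<longrightarrow> (\<Sum>i<n. \<bar>F (y i) - F (x i)\<bar>) < e"
    proof (intro exI[of _ \<delta>] conjI allI impI \<delta>(1))
      fix n :: nat and x y :: "nat \<Rightarrow> real"
      assume xy: "\<forall>i<n. x i \<le> y i \<and> {x i..y i} \<subseteq> {a..t}"
        and disj: "disjoint_family_on (\<lambda>i. {x i<..<y i}) {..<n}"
        and sum: "(\<Sum>i<n. y i - x i) < \<delta>"
      have xyi: "a \<le> x i" "x i \<le> y i" "y i \<le> t" if "i < n" for i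
      proof -
        have "x i \<le> y i" "{x i..y i} \<subseteq> {a..t}" using xy that by auto
        then show "a \<le> x i" "x i \<le> y i" "y i \<le> t" by auto
      qed
      have "((\<lambda>s. \<Sum>i<n. \<bar>F (max s (y i)) - F (max s (x i))\<bar>) \<longlongrightarrow> (\<Sum>i<n. \<bar>F (y i) - F (x i)\<bar>)) (at_right a)"
        using xyi by (intro tendsto_sum tendsto_rabs tendsto_diff Flim) force+
      \<comment> \<open>Clipped intervals lie inside the open interval, stay disjoint and are no
        longer than before.\<close>
      moreover have "\<forall>\<^sub>F s in at_right a. (\<Sum>i<n. \<bar>F (max s (y i)) - F (max s (x i))\<bar>) \<le> e / 2"
        using s
      proof eventually_elim
        case (elim s)
        have "(\<Sum>i<n. \<bar>f (max s (y i)) - f (max s (x i))\<bar>) < e / 2"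
        proof (rule \<delta>(2)[rule_format])
          show "max s (x i) \<le> max s (y i) \<and> {max s (x i)..max s (y i)} \<subseteq> {a<..<b}" if "i < n" for i
            using xyi[OF that] elim t by auto
          show "disjoint_family_on (\<lambda>i. {max s (x i)<..<max s (y i)}) {..<n}"
            using disj unfolding disjoint_family_on_def by fastforce
          have "(\<Sum>i<n. max s (y i) - max s (x i)) \<le> (\<Sum>i<n. y i - x i)"
            using xyi by (intro sum_mono) (force simp: max_def)
          then show "(\<Sum>i<n. max s (y i) - max s (x i)) < \<delta>" using sum by linarith
        qed
        moreover have "F (max s z) = f (max s z)" for z using elim by (simp add: F_def)
        ultimately show ?case by simp
      qed
      ultimately have "(\<Sum>i<n. \<bar>F (y i) - F (x i)\<bar>) \<le> e / 2"
        by (rule tendsto_upperbound) simp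
      then show "(\<Sum>i<n. \<bar>F (y i) - F (x i)\<bar>) < e" using e by linarith
    qed
  qed
  then show ?thesis by (simp only: F_def)
qed

section \<open>The Caputo-Fabrizio operator\<close>

text \<open>The exponential series is integrated termwise: with \<open>F\<close> bounded by
  \<open>B\<close>, its terms are dominated on the interval by
  \<open>B * ((\<bar>z\<bar> * (t - a)) ^ k / fact k)\<close>, so the convergence is
  uniform.\<close>

lemma exp_kernel_integral_sums:
  fixes F :: "real \<Rightarrow> real"
  assumes F: "continuous_on {a..t} F"
  shows "(\<lambda>k. z ^ k / fact k * integral {a..t} (\<lambda>x. F x * (t - x) ^ k))
    sums integral {a..t} (\<lambda>x. exp (z * (t - x)) * F x)"
proof -
  have "bounded (F ` {a..t})"
    by (intro compact_imp_bounded compact_continuous_image F) simp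
  then obtain B where B: "0 < B" "\<And>x. x \<in> {a..t} \<Longrightarrow> \<bar>F x\<bar> \<le> B" by (auto simp: bounded_pos)
  let ?q = "\<lambda>k x. z ^ k / fact k * (F x * (t - x) ^ k)"
  let ?r = "\<bar>z\<bar> * (t - a)"
  have exp: "(\<lambda>k. w ^ k / fact k) sums exp w" for w :: real
    using exp_converges[of w] by (simp add: field_simps)
  have "uniform_limit {a..t} (\<lambda>n x. \<Sum>k<n. ?q k x) (\<lambda>x. \<Sum>k. ?q k x) sequentially"
  proof (rule Weierstrass_m_test)
    show "summable (\<lambda>k. B * (?r ^ k / fact k))"
      by (intro summable_mult sums_summable[OF exp])
    fix k x assume x: "x \<in> {a..t}"
    have "\<bar>t - x\<bar> ^ k \<le> (t - a) ^ k" using x by (intro power_mono) auto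
    then have "\<bar>F x\<bar> * \<bar>t - x\<bar> ^ k \<le> B * (t - a) ^ k"
      using B(2)[OF x] B(1) by (intro mult_mono) auto
    then have "\<bar>z\<bar> ^ k / fact k * (\<bar>F x\<bar> * \<bar>t - x\<bar> ^ k) \<le> \<bar>z\<bar> ^ k / fact k * (B * (t - a) ^ k)"
      by (intro mult_left_mono) auto
    then show "norm (?q k x) \<le> B * (?r ^ k / fact k)"
      by (simp add: abs_mult power_abs power_mult_distrib mult.left_commute)
  qed
  moreover have "(\<Sum>k. ?q k x) = exp (z * (t - x)) * F x" for x
    using sums_mult2[OF exp[of "z * (t - x)"], of "F x"]
    by (intro sums_unique[symmetric]) (simp add: power_mult_distrib mult_ac)
  ultimately have ul: "uniform_limit (cbox a t) (\<lambda>n x. \<Sum>k<n. ?q k x) (\<lambda>x. exp (z * (t - x)) * F x) sequentially"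
    by simp
  have cq: "continuous_on {a..t} (?q k)" for k by (intro continuous_intros F)
  have "continuous_on (cbox a t) (\<lambda>x. \<Sum>k<n. ?q k x)" for n
    using cq by (auto intro!: continuous_on_sum)
  from uniform_limit_integral_cbox[OF ul this]
  obtain I J where IJ: "\<And>n. ((\<lambda>x. \<Sum>k<n. ?q k x) has_integral I n) (cbox a t)"
    "((\<lambda>x. exp (z * (t - x)) * F x) has_integral J) (cbox a t)" "I \<longlonglongrightarrow> J" by auto
  have "I = (\<lambda>n. \<Sum>k<n. z ^ k / fact k * integral {a..t} (\<lambda>x. F x * (t - x) ^ k))"
  proof
    fix n
    have "I n = integral {a..t} (\<lambda>x. \<Sum>k<n. ?q k x)" using IJ(1)[of n] by (simp add: integral_unique)
    also have "\<dots> = (\<Sum>k<n. integral {a..t} (?q k))"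
      by (intro integral_sum integrable_continuous_real cq) simp
    finally show "I n = (\<Sum>k<n. z ^ k / fact k * integral {a..t} (\<lambda>x. F x * (t - x) ^ k))" by simp
  qed
  moreover have "J = integral {a..t} (\<lambda>x. exp (z * (t - x)) * F x)"
    using IJ(2) by (simp add: integral_unique)
  ultimately show ?thesis using IJ(3) by (simp only: sums_def)
qed

text \<open>On the open interval \<open>t - x\<close> is positive, so \<open>powr\<close> is an
  ordinary power, and \<open>Gamma (k + 1)\<close> is \<open>fact k\<close>. Only values strictly
  between \<open>a\<close> and \<open>t\<close> enter, so the continuous \<open>F\<close> may
  replace \<open>f\<close>.\<close>

lemma riemann_liouville_Suc_eq_integral:
  assumes F: "continuous_on {a..t} F" and eq: "\<And>x. a < x \<Longrightarrow> x < t \<Longrightarrow> f x = F x"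
  shows "riemann_liouville (real (Suc k)) a f t = integral {a..t} (\<lambda>x. F x * (t - x) ^ k) / fact k"
proof -
  have "(LINT x:{a<..<t}|lebesgue. f x * (t - x) powr (real (Suc k) - 1))
      = (LINT x:{a<..<t}|lebesgue. F x * (t - x) ^ k)"
    by (rule set_lebesgue_integral_cong) (auto simp: eq powr_realpow)
  also have "\<dots> = integral {a<..<t} (\<lambda>x. F x * (t - x) ^ k)"
  proof (rule set_lebesgue_integral_eq_integral(2))
    have "(\<lambda>x. F x * (t - x) ^ k) absolutely_integrable_on {a..t}"
      by (intro absolutely_integrable_continuous_real continuous_intros F)
    then show "(\<lambda>x. F x * (t - x) ^ k) absolutely_integrable_on {a<..<t}"
      by (rule set_integrable_subset) auto
  qed
  also have "\<dots> = integral {a..t} (\<lambda>x. F x * (t - x) ^ k)"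
    by (rule integral_open_interval_real[symmetric])
  finally show ?thesis
    using Gamma_fact[of k, where 'a = real] by (simp add: riemann_liouville_def)
qed

text \<open>An infinite sum has an unspecified value when the series diverges, so convergence is
  stated together with the identity.\<close>

theorem theorem4:
  fixes a b \<alpha> t :: real and f M :: "real \<Rightarrow> real"
  assumes "a < b"
    and "absolutely_continuous_on {a<..<b} f"
    and "0 < \<alpha>" and "\<alpha> < 1"
    and "M 0 = 1" and "M 1 = 1"
    and "t \<in> {a<..<b}"
  shows "summable (\<lambda>k::nat. (- (\<alpha> / (1 - \<alpha>))) ^ k * riemann_liouville (real k) a f t) \<and>
    caputo_fabrizio M \<alpha> a f t =
      - (M \<alpha> * Lim (at_right a) f / (1 - \<alpha>)) * exp (- (\<alpha> * (t - a) / (1 - \<alpha>)))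
      + M \<alpha> / (1 - \<alpha>) *
        (\<Sum>k::nat. (- (\<alpha> / (1 - \<alpha>))) ^ k * riemann_liouville (real k) a f t)"
proof -
  define c where "c = \<alpha> / (1 - \<alpha>)"
  define l where "l = Lim (at_right a) f"
  \<comment> \<open>Agrees with \<open>f\<close> on \<open>(a, t]\<close> and is absolutely
    continuous up to \<open>a\<close>.\<close>
  define F where "F = (\<lambda>x. if x \<le> a then l else f x)"
  define g where "g = (\<lambda>x. exp (- c * (t - x)))"
  define I where "I = integral {a..t} (\<lambda>x. g x * F x)"
  have t: "a < t" "t < b" using assms(7) by auto
  have F: "absolutely_continuous_on {a..t} F"
    unfolding F_def l_def by (rule absolutely_continuous_on_Icc_extension[OF assms(2) t])
  have cF: "continuous_on {a..t} F"
    by (intro uniformly_continuous_imp_continuous absolutely_continuous_on_imp_uniformly_continuous F)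
      (rule is_interval_cc)

  \<comment> \<open>The derivative of the kernel is \<open>c\<close> times the kernel, so
    integration by parts returns the integral \<open>I\<close>.\<close>
  have g: "(g has_real_derivative c * g x) (at x)" for x
    unfolding g_def by (auto intro!: derivative_eq_intros)
  have "continuous_on {a..t} (\<lambda>x. c * g x)" unfolding g_def by (intro continuous_intros)
  note ibp = absolutely_continuous_integration_by_parts[OF F less_imp_le[OF t(1)] g this]
  have deriv: "deriv f x = deriv F x" if "x \<in> {a<..<t}" for x
  proof (rule deriv_cong_ev)
    have "\<forall>\<^sub>F y in nhds x. y \<in> {a<..<t}" using that by (intro eventually_nhds_in_open) auto
    then show "\<forall>\<^sub>F y in nhds x. f y = F y" by eventually_elim (simp add: F_def)
  qed simp
  have "(LINT x:{a<..<t}|lebesgue. exp (- (\<alpha> / (1 - \<alpha>)) * (t - x)) * deriv f x)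
      = (LINT x:{a<..<t}|lebesgue. g x * deriv F x)"
    by (rule set_lebesgue_integral_cong) (auto simp: g_def c_def deriv)
  also have "\<dots> = integral {a<..<t} (\<lambda>x. g x * deriv F x)"
    by (intro set_lebesgue_integral_eq_integral(2) set_integrable_subset[OF ibp(1)]) auto
  also have "\<dots> = integral {a..t} (\<lambda>x. g x * deriv F x)"
    by (rule integral_open_interval_real[symmetric])
  \<comment> \<open>Boundary terms: \<open>g t = 1\<close>, \<open>F t = f t\<close>, and
    \<open>F a\<close> is the limit \<open>l\<close>.\<close>
  also have "\<dots> = f t - exp (- (c * (t - a))) * l - c * I"
    unfolding ibp(2) using t(1) by (simp add: F_def g_def I_def mult.assoc)
  finally have cf: "caputo_fabrizio M \<alpha> a f t
      = M \<alpha> / (1 - \<alpha>) * (f t - exp (- (c * (t - a))) * l - c * I)"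
    by (simp only: caputo_fabrizio_def)

  let ?s = "\<lambda>k. (- c) ^ k * riemann_liouville (real k) a f t"
  \<comment> \<open>Multiplying by \<open>- c\<close> shifts the index: term \<open>k\<close> of the
    exponential series, with its \<open>1 / fact k\<close>, becomes term \<open>k + 1\<close> of the
    Riemann-Liouville series.\<close>
  have "(\<lambda>k. - c * ((- c) ^ k / fact k * integral {a..t} (\<lambda>x. F x * (t - x) ^ k))) sums (- c * I)"
    unfolding I_def g_def by (intro sums_mult exp_kernel_integral_sums cF)
  moreover have "riemann_liouville (real (Suc k)) a f t = integral {a..t} (\<lambda>x. F x * (t - x) ^ k) / fact k" for k
    by (rule riemann_liouville_Suc_eq_integral[OF cF]) (simp add: F_def)
  ultimately have "(\<lambda>k. ?s (Suc k)) sums (- c * I)"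
    by (simp only: power_Suc mult.assoc times_divide_eq_left times_divide_eq_right)
  \<comment> \<open>The missing term of index 0 is \<open>f t\<close>, by the convention for order
    zero.\<close>
  then have "?s sums (- c * I + ?s 0)" by (rule sums_Suc)
  then have s: "?s sums (f t - c * I)" by (simp add: riemann_liouville_def)

  have c': "\<alpha> * (t - a) / (1 - \<alpha>) = c * (t - a)" by (simp add: c_def)
  have "A * (x - E * l - y) = - (A * l) * E + A * (x - y)" for A x y E :: real
    by (simp add: algebra_simps)
  then show ?thesis
    unfolding c' c_def[symmetric] l_def[symmetric] cf sums_unique[OF s, symmetric]
      times_divide_eq_left[symmetric]
    using sums_summable[OF s] by blast
qed

end
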